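(* Let $k$ be a commutative ring of characteristic zero. For each $m,N\in\mathbb N$ there is an injective homomorphism of groups $$\alpha_{N,m}:\ \mathrm{Aut}_k\big(k[[x_1,\dots,x_m]]/(x_1,\dots,x_m)^{N+1}\big)\hookrightarrow \mathrm{GA}_{N\cdot m}(k).$$ If $$\phi=(\phi_1,\dots,\phi_m)\in \mathrm{Aut}_k\big(k[[x_1,\dots,x_m]]/(x_1,\dots,x_m)^{N+1}\big),$$ where $\phi_i=\phi_i(x_1,\dots,x_m)$ are $N$-truncated power series, and $y_{ij}$, $1\leq i\leq m$, $1\leq j\leq N$, are the coordinates of affine $N\cdot m$-space, then the $\alpha_{N,m}(\phi)(y_{ij})$ are polynomials of degree at most $N$. Their coefficients are given by universal explicit easy formulas in the coefficients of the power series $\phi_i$.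
   Context: $\mathbb N$ denotes the positive integers. $\mathrm{GA}_n(k)$ denotes the general polynomial automorphism group, i.e. the group of $k$-algebra automorphisms of the polynomial ring in $n$ variables over $k$; here $n=N\cdot m$ and the variables are named $y_{ij}$, $1\leq i\leq m$, $1\leq j\leq N$. $\mathrm{Aut}_k\big(k[[x_1,\dots,x_m]]/(x_1,\dots,x_m)^{N+1}\big)$ denotes the group of $k$-algebra automorphisms $\phi$ of the truncated power series ring $k[[x_1,\dots,x_m]]/(x_1,\dots,x_m)^{N+1}$ that preserve the ideal generated by $x_1,\dots,x_m$. Such a $\phi$ is written $\phi=(\phi_1,\dots,\phi_m)$, where $\phi_i=\phi(x_i)$ is a power series without constant term, truncated above total degree $N$. "Universal" means that the formulas do not depend on the ground ring $k$. *)

theory Defs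
  imports
    "HOL-Library.Poly_Mapping"
    "HOL-Algebra.Bij"
    "HOL-Algebra.QuotRing"
    "HOL-Algebra.Ideal_Product"
begin

text \<open>A monomial in variables of type \<open>'x\<close> is given by its exponent vector.\<close>

type_synonym 'x monomial = "'x \<Rightarrow>\<^sub>0 nat"

definition mdeg :: "'x monomial \<Rightarrow> nat" where
  "mdeg a = (\<Sum>v\<in>Poly_Mapping.keys a. Poly_Mapping.lookup a v)"

text \<open>
  The map \<open>\<iota>\<close> is the structure map of the \<open>k\<close>-algebra \<open>A\<close>.  As for
  \<open>AutoGroup\<close>, automorphisms are extensional on the carrier, and the product of
  \<open>g\<close> and \<open>f\<close> is the map \<open>x \<mapsto> g (f x)\<close>.
\<close>

definition alg_aut :: "('a, 'b) ring_scheme \<Rightarrow> ('k \<Rightarrow> 'a) \<Rightarrow> ('a \<Rightarrow> 'a) set" where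
  "alg_aut A \<iota> = {f \<in> ring_iso A A. f \<in> extensional (carrier A) \<and> (\<forall>c. f (\<iota> c) = \<iota> c)}"

text \<open>
  \<open>'x monomial \<Rightarrow>\<^sub>0 'k\<close> is the polynomial ring in all variables of type \<open>'x\<close>;
  \<open>poly_ring V\<close> is its subring of polynomials that involve only the variables in \<open>V\<close>.
\<close>

type_synonym ('x, 'k) polynomial = "'x monomial \<Rightarrow>\<^sub>0 'k"

definition poly_ring :: "'x set \<Rightarrow> ('x, 'k::comm_ring_1) polynomial ring" where
  "poly_ring V =
    \<lparr>carrier = {p. \<forall>a\<in>Poly_Mapping.keys p. Poly_Mapping.keys a \<subseteq> V},
     mult = (*), one = 1, zero = 0, add = (+)\<rparr>"

definition poly_const :: "'k::comm_ring_1 \<Rightarrow> ('x, 'k) polynomial" where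
  "poly_const c = Poly_Mapping.single 0 c"

definition poly_var :: "'x \<Rightarrow> ('x, 'k::comm_ring_1) polynomial" where
  "poly_var v = Poly_Mapping.single (Poly_Mapping.single v 1) 1"

text \<open>The total degree, with the convention that the zero polynomial has degree 0.\<close>

definition total_degree :: "('x, 'k::comm_ring_1) polynomial \<Rightarrow> nat" where
  "total_degree p = Max (insert 0 (mdeg ` Poly_Mapping.keys p))"

definition GA :: "'x set \<Rightarrow> (('x, 'k::comm_ring_1) polynomial \<Rightarrow> ('x, 'k) polynomial) monoid" where
  "GA V = BijGroup (carrier (poly_ring V)) \<lparr>carrier := alg_aut (poly_ring V) poly_const\<rparr>"

text \<open>
  A power series is its function of coefficients.  The variables of
  \<open>power_series_ring m\<close> are \<open>x\<^sub>1, \<dots>, x\<^sub>m\<close>, with indices from 1.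
\<close>

type_synonym 'k power_series = "nat monomial \<Rightarrow> 'k"

definition power_series_ring :: "nat \<Rightarrow> 'k::comm_ring_1 power_series ring" where
  "power_series_ring m =
    \<lparr>carrier = {f. \<forall>a. f a \<noteq> 0 \<longrightarrow> Poly_Mapping.keys a \<subseteq> {1..m}},
     mult = (\<lambda>f g a. \<Sum>(b, c) | b + c = a. f b * g c),
     one = (\<lambda>a. if a = 0 then 1 else 0),
     zero = (\<lambda>a. 0),
     add = (\<lambda>f g a. f a + g a)\<rparr>"

definition ps_const :: "'k::comm_ring_1 \<Rightarrow> 'k power_series" where
  "ps_const c = (\<lambda>a. if a = 0 then c else 0)"

definition ps_var :: "nat \<Rightarrow> 'k::comm_ring_1 power_series" where
  "ps_var i = (\<lambda>a. if a = Poly_Mapping.single i 1 then 1 else 0)"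

text \<open>The ideal \<open>(x\<^sub>1, \<dots>, x\<^sub>m)\<^bsup>N+1\<^esup>\<close>; the product of \<open>ideals_set R\<close> is the product of ideals.\<close>

definition trunc_ideal :: "nat \<Rightarrow> nat \<Rightarrow> 'k::comm_ring_1 power_series set" where
  "trunc_ideal m N =
    (let R = power_series_ring m
     in (Idl\<^bsub>R\<^esub> (ps_var ` {1..m})) [^]\<^bsub>ideals_set R\<^esub> (N + 1))"

definition trunc_ring :: "nat \<Rightarrow> nat \<Rightarrow> 'k::comm_ring_1 power_series set ring" where
  "trunc_ring m N = power_series_ring m Quot trunc_ideal m N"

definition trunc_class :: "nat \<Rightarrow> nat \<Rightarrow> 'k::comm_ring_1 power_series \<Rightarrow> 'k power_series set" where
  "trunc_class m N f = trunc_ideal m N +>\<^bsub>power_series_ring m\<^esub> f"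

text \<open>
  The coefficient of a truncated power series at a monomial \<open>a\<close> of degree at most \<open>N\<close>: the
  common value at \<open>a\<close> of all representatives.  At monomials in \<open>x\<^sub>1, \<dots>, x\<^sub>m\<close> of degree
  above \<open>N\<close> there is no such common value, and the result is unspecified.
\<close>

definition trunc_coeff :: "'k power_series set \<Rightarrow> nat monomial \<Rightarrow> 'k" where
  "trunc_coeff C a = (THE c. \<forall>f\<in>C. f a = c)"

definition var_ideal :: "nat \<Rightarrow> nat \<Rightarrow> 'k::comm_ring_1 power_series set set" where
  "var_ideal m N = Idl\<^bsub>trunc_ring m N\<^esub> ((\<lambda>i. trunc_class m N (ps_var i)) ` {1..m})"

definition trunc_Aut ::
    "nat \<Rightarrow> nat \<Rightarrow> ('k::comm_ring_1 power_series set \<Rightarrow> 'k power_series set) monoid" where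
  "trunc_Aut m N = BijGroup (carrier (trunc_ring m N))
    \<lparr>carrier := {\<phi> \<in> alg_aut (trunc_ring m N) (\<lambda>c. trunc_class m N (ps_const c)).
                  \<phi> ` var_ideal m N = var_ideal m N}\<rparr>"

definition component ::
    "nat \<Rightarrow> nat \<Rightarrow> ('k::comm_ring_1 power_series set \<Rightarrow> 'k power_series set) \<Rightarrow> nat
      \<Rightarrow> 'k power_series set" where
  "component m N \<phi> i = \<phi> (trunc_class m N (ps_var i))"

text \<open>
  Put \<open>Y\<^sub>l = \<Sum>\<^sub>s y\<^sub>l\<^sub>s t\<^sup>s\<close>, where \<open>s\<close> runs from 1 to \<open>N\<close>.  The image of \<open>y\<^sub>i\<^sub>j\<close> is the
  coefficient of \<open>t\<^sup>j\<close> in \<open>\<phi>\<^sub>i(Y\<^sub>1, \<dots>, Y\<^sub>m)\<close>.  By the multinomial theorem, the monomial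
  with exponents \<open>\<mu>\<^sub>l\<^sub>s\<close> in the \<open>y\<^sub>l\<^sub>s\<close> occurs in \<open>Y\<^bsup>a\<^esup> = \<Prod>\<^sub>l (Y\<^sub>l)\<^bsup>a l\<^esup>\<close> only if
  \<open>a l = \<Sum>\<^sub>s \<mu>\<^sub>l\<^sub>s\<close> for all \<open>l\<close>, that is if \<open>a = row_exponent \<mu>\<close>.  It then occurs with
  \<open>t\<close>-exponent \<open>weight \<mu>\<close> and the factor \<open>\<Prod>\<^sub>l (a l)! / \<Prod>\<^sub>l\<^sub>s (\<mu>\<^sub>l\<^sub>s)!\<close>.  None of the
  constants below refers to the ground ring, which is what makes the formulas universal.
\<close>

definition weight :: "(nat \<times> nat) monomial \<Rightarrow> nat" where
  "weight \<mu> = (\<Sum>(l, s)\<in>Poly_Mapping.keys \<mu>. s * Poly_Mapping.lookup \<mu> (l, s))"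

definition row_exponent :: "(nat \<times> nat) monomial \<Rightarrow> nat monomial" where
  "row_exponent \<mu> =
    (\<Sum>(l, s)\<in>Poly_Mapping.keys \<mu>. Poly_Mapping.single l (Poly_Mapping.lookup \<mu> (l, s)))"

definition multinomial_factor :: "(nat \<times> nat) monomial \<Rightarrow> nat" where
  "multinomial_factor \<mu> =
    (\<Prod>l\<in>Poly_Mapping.keys (row_exponent \<mu>). fact (Poly_Mapping.lookup (row_exponent \<mu>) l))
      div (\<Prod>v\<in>Poly_Mapping.keys \<mu>. fact (Poly_Mapping.lookup \<mu> v))"

definition universal_factor :: "nat \<Rightarrow> (nat \<times> nat) monomial \<Rightarrow> nat" where
  "universal_factor j \<mu> = (if weight \<mu> = j then multinomial_factor \<mu> else 0)"

end

theory Submission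
  imports Defs
begin

text \<open>
  Substituting \<open>x\<^sub>l \<mapsto> Y\<^sub>l = \<Sum>\<^sub>s y\<^sub>l\<^sub>s t\<^sup>s\<close> gives a homomorphism \<open>E\<close> from the truncated power series
  to the truncated polynomials in \<open>t\<close> over \<open>k[y]\<close>.  Let \<open>\<alpha> \<phi>\<close> send \<open>y\<^sub>i\<^sub>j\<close> to the coefficient of
  \<open>t\<^sup>j\<close> in \<open>E (\<phi>\<^sub>i)\<close>.  As \<open>\<phi>\<^sub>i\<close> has no constant term, \<open>\<alpha> \<phi>\<close>, applied coefficientwise, maps \<open>Y\<^sub>i\<close> to
  \<open>E (\<phi>\<^sub>i)\<close>.  Hence \<open>\<alpha> \<phi> \<circ> E = E \<circ> \<phi>\<close>, both sides being homomorphisms that agree on the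
  \<open>x\<^sub>i\<close>, and comparing \<open>\<alpha> \<phi> \<circ> \<alpha> \<psi> \<circ> E\<close> with \<open>E \<circ> \<phi> \<circ> \<psi>\<close> on the \<open>x\<^sub>i\<close> shows that \<open>\<alpha>\<close> is
  multiplicative.  It is injective since the coefficient of \<open>x\<^sup>a\<close> in \<open>\<phi>\<^sub>i\<close> is that of
  \<open>\<Prod>\<^sub>l (y\<^sub>l\<^sub>1)\<^bsup>a l\<^esup>\<close> in the image of \<open>y\<^sub>i\<^sub>j\<close> for \<open>j = |a|\<close>.
\<close>

abbreviation lookup where "lookup \<equiv> Poly_Mapping.lookup"
abbreviation keys where "keys \<equiv> Poly_Mapping.keys"
abbreviation single where "single \<equiv> Poly_Mapping.single"

section \<open>Monomials\<close>

lemma keys_add_monomial: "keys (a + b) = keys a \<union> keys b" for a b :: "'x monomial"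
  by (auto simp: in_keys_iff lookup_add)

lemma monomial_split_key:
  fixes a :: "'x monomial"
  assumes "v \<in> keys a"
  shows "(a - single v 1) + single v 1 = a"
  using assms by (intro poly_mapping_eqI)
    (auto simp: lookup_add lookup_minus lookup_single when_def in_keys_iff)

lemma sum_keys_superset:
  assumes "finite A" and "keys a \<subseteq> A" and "\<And>v. g v 0 = 0"
  shows "(\<Sum>v\<in>keys a. g v (lookup a v)) = (\<Sum>v\<in>A. g v (lookup a v))"
  using assms by (intro sum.mono_neutral_left) (auto simp: in_keys_iff)

text \<open>Both supports are enlarged to that of \<open>a + b\<close>, where the terms add up one
  by one. \<open>mdeg\<close>, \<open>weight\<close> and \<open>row_exponent\<close> get their
  additivity from here.\<close>

lemma sum_keys_add:
  fixes a b :: "'x monomial"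
  assumes "\<And>v. g v 0 = 0" and "\<And>v p q. g v (p + q) = g v p + g v q"
  shows "(\<Sum>v\<in>keys (a + b). g v (lookup (a + b) v))
    = (\<Sum>v\<in>keys a. g v (lookup a v)) + (\<Sum>v\<in>keys b. g v (lookup b v))"
proof -
  have "(\<Sum>v\<in>keys a. g v (lookup a v)) = (\<Sum>v\<in>keys (a + b). g v (lookup a v))"
    "(\<Sum>v\<in>keys b. g v (lookup b v)) = (\<Sum>v\<in>keys (a + b). g v (lookup b v))"
    using assms(1) by (auto intro!: sum_keys_superset simp: keys_add_monomial)
  then show ?thesis
    by (simp add: lookup_add assms(2) sum.distrib)
qed

lemma mdeg_add [simp]: "mdeg (a + b) = mdeg a + mdeg b"
  unfolding mdeg_def by (rule sum_keys_add) auto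

lemma mdeg_zero [simp]: "mdeg 0 = 0"
  by (simp add: mdeg_def)

lemma mdeg_single [simp]: "mdeg (single v n) = n"
  by (simp add: mdeg_def)

lemma lookup_le_mdeg: "lookup a v \<le> mdeg a"
proof (cases "v \<in> keys a")
  case True
  then show ?thesis unfolding mdeg_def by (intro member_le_sum) auto
qed (simp add: in_keys_iff)

lemma mdeg_eq_0_iff [simp]: "mdeg a = 0 \<longleftrightarrow> a = 0"
proof
  assume "mdeg a = 0"
  then show "a = 0"
    using lookup_le_mdeg[of a] by (intro poly_mapping_eqI) simp
qed simp

text \<open>A monomial is determined by its exponent function, and there are finitely many such
  functions from \<open>V\<close> to \<open>{..B}\<close>. This gives the finiteness of the
  decompositions of a monomial, of the support of a jet, and of the part of a series of degree at
  most \<open>N\<close>.\<close>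

lemma finite_bounded_monomials:
  assumes "finite V"
  shows "finite {a :: 'x monomial. keys a \<subseteq> V \<and> (\<forall>v. lookup a v \<le> B)}"
proof (rule finite_imageD)
  show "inj_on lookup {a :: 'x monomial. keys a \<subseteq> V \<and> (\<forall>v. lookup a v \<le> B)}"
    by (simp add: inj_on_def lookup_inject)
  have "lookup ` {a :: 'x monomial. keys a \<subseteq> V \<and> (\<forall>v. lookup a v \<le> B)}
      \<subseteq> {f. \<forall>v. (v \<in> V \<longrightarrow> f v \<in> {..B}) \<and> (v \<notin> V \<longrightarrow> f v = 0)}"
    by (auto simp: in_keys_iff subset_iff)
  then show "finite (lookup ` {a :: 'x monomial. keys a \<subseteq> V \<and> (\<forall>v. lookup a v \<le> B)})"
    using finite_set_of_finite_funs[OF assms, of "{..B}" 0] finite_subset by blast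
qed

section \<open>Decompositions of a monomial into two factors\<close>

definition splits :: "'x monomial \<Rightarrow> ('x monomial \<times> 'x monomial) set" where
  "splits a = {(b, c). b + c = a}"

lemma splits_iff [simp]: "(b, c) \<in> splits a \<longleftrightarrow> b + c = a"
  by (simp add: splits_def)

lemma finite_splits [simp]: "finite (splits a)"
proof -
  let ?M = "{b. keys b \<subseteq> keys a \<and> (\<forall>v. lookup b v \<le> mdeg a)}"
  have "splits a \<subseteq> ?M \<times> ?M"
    by (auto simp: splits_def keys_add_monomial intro: order_trans[OF lookup_le_mdeg])
  then show ?thesis
    using finite_bounded_monomials[of "keys a" "mdeg a"] by (simp add: finite_subset)
qed

text \<open>Either side sums \<open>F\<close> over all triples with \<open>b + d + c = a\<close>.
  This is the associativity of the product of power series.\<close>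

lemma sum_splits_assoc:
  fixes F :: "'x monomial \<Rightarrow> 'x monomial \<Rightarrow> 'x monomial \<Rightarrow> 'a::comm_monoid_add"
  shows "(\<Sum>(p, c)\<in>splits a. \<Sum>(b, d)\<in>splits p. F b d c)
    = (\<Sum>(b, q)\<in>splits a. \<Sum>(d, c)\<in>splits q. F b d c)"
proof -
  have "(\<Sum>(p, c)\<in>splits a. \<Sum>(b, d)\<in>splits p. F b d c)
    = (\<Sum>((p, c), (b, d))\<in>Sigma (splits a) (\<lambda>(p, c). splits p). F b d c)"
    by (subst sum.Sigma[symmetric]) (auto simp: case_prod_unfold)
  also have "\<dots> = (\<Sum>((b, q), (d, c))\<in>Sigma (splits a) (\<lambda>(b, q). splits q). F b d c)"
    by (rule sum.reindex_bij_witness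
        [of _ "\<lambda>((b, q), (d, c)). ((b + d, c), (b, d))" "\<lambda>((p, c), (b, d)). ((b, d + c), (d, c))"])
      (auto simp: add.assoc)
  also have "\<dots> = (\<Sum>(b, q)\<in>splits a. \<Sum>(d, c)\<in>splits q. F b d c)"
    by (subst sum.Sigma[symmetric]) (auto simp: case_prod_unfold)
  finally show ?thesis .
qed

lemma sum_splits_commute:
  "(\<Sum>(b, c)\<in>splits a. F b c) = (\<Sum>(b, c)\<in>splits a. F c b)"
  by (rule sum.reindex_bij_witness[of _ "\<lambda>(b, c). (c, b)" "\<lambda>(b, c). (c, b)"])
    (auto simp: add.commute)

text \<open>Brings the product of polynomials to the index set used for the product of power series,
  so that \<open>jet_mult\<close> can compare the two.\<close>

lemma lookup_mult_splits:
  fixes p q :: "'x monomial \<Rightarrow>\<^sub>0 'k::comm_semiring_1"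
  shows "lookup (p * q) a = (\<Sum>(b, c)\<in>splits a. lookup p b * lookup q c)"
proof -
  have "lookup (p * q) a
      = (\<Sum>(b, c). lookup p b * lookup q c when a = b + c)"
    unfolding lookup_mult prod_fun_def[symmetric] by (rule prod_fun_unfold_prod) simp_all
  also have "\<dots> = (\<Sum>(b, c)\<in>splits a. lookup p b * lookup q c when a = b + c)"
    by (rule Sum_any.expand_superset[OF finite_splits]) (auto split: if_splits)
  also have "\<dots> = (\<Sum>(b, c)\<in>splits a. lookup p b * lookup q c)"
    by (rule sum.cong) (auto simp: when_def)
  finally show ?thesis .
qed

section \<open>Multinomial coefficients\<close>

lemma weight_add [simp]: "weight (a + b) = weight a + weight b"
  using sum_keys_add[of "\<lambda>(l, s) n. s * n" a b]
  by (simp add: weight_def case_prod_unfold algebra_simps)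

lemma weight_zero [simp]: "weight 0 = 0"
  by (simp add: weight_def)

lemma row_exponent_add [simp]: "row_exponent (a + b) = row_exponent a + row_exponent b"
  using sum_keys_add[of "\<lambda>(l, s) n. single l n" a b]
  by (simp add: row_exponent_def case_prod_unfold single_add)

lemma row_exponent_zero [simp]: "row_exponent 0 = 0"
  by (simp add: row_exponent_def)

lemma row_exponent_single [simp]: "row_exponent (single (l, s) n) = single l n"
  by (simp add: row_exponent_def)

lemma weight_single [simp]: "weight (single (l, s) n) = s * n"
  by (simp add: weight_def)

lemma mdeg_sum: "mdeg (sum f A) = (\<Sum>x\<in>A. mdeg (f x))"
  by (induction A rule: infinite_finite_induct) auto

lemma mdeg_row_exponent [simp]: "mdeg (row_exponent \<mu>) = mdeg \<mu>"
  unfolding row_exponent_def by (simp add: mdeg_sum case_prod_unfold) (simp add: mdeg_def)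

lemma lookup_row_exponent:
  "lookup (row_exponent \<mu>) l = (\<Sum>s | (l, s) \<in> keys \<mu>. lookup \<mu> (l, s))"
proof -
  have "lookup (row_exponent \<mu>) l = (\<Sum>v\<in>keys \<mu>. if fst v = l then lookup \<mu> v else 0)"
    by (simp add: row_exponent_def lookup_sum case_prod_unfold lookup_single when_def)
  also have "\<dots> = (\<Sum>v\<in>{v \<in> keys \<mu>. fst v = l}. lookup \<mu> v)"
    by (simp add: sum.inter_filter)
  also have "\<dots> = (\<Sum>s | (l, s) \<in> keys \<mu>. lookup \<mu> (l, s))"
    by (rule sum.reindex_bij_witness[of _ "\<lambda>s. (l, s)" snd]) auto
  finally show ?thesis .
qed

lemma keys_row_exponent: "keys (row_exponent \<mu>) \<subseteq> fst ` keys \<mu>"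
proof
  fix l assume "l \<in> keys (row_exponent \<mu>)"
  then have "(\<Sum>s | (l, s) \<in> keys \<mu>. lookup \<mu> (l, s)) \<noteq> 0"
    by (simp add: in_keys_iff lookup_row_exponent)
  then obtain s where "(l, s) \<in> keys \<mu>"
    by (metis (mono_tags, lifting) mem_Collect_eq sum.neutral in_keys_iff)
  then show "l \<in> fst ` keys \<mu>" by force
qed

lemma row_exponent_eq_0_iff [simp]: "row_exponent \<mu> = 0 \<longleftrightarrow> \<mu> = 0"
  by (metis mdeg_eq_0_iff mdeg_row_exponent)

section \<open>Factorials of monomials, Pascal's rule and Vandermonde's identity\<close>

definition mono_fact :: "'x monomial \<Rightarrow> nat" where
  "mono_fact a = (\<Prod>v\<in>keys a. fact (lookup a v))"

lemma mono_fact_pos: "mono_fact a > 0"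
  by (simp add: mono_fact_def prod_pos)

lemma mono_fact_superset:
  assumes "finite A" and "keys a \<subseteq> A"
  shows "mono_fact a = (\<Prod>v\<in>A. fact (lookup a v))"
  unfolding mono_fact_def using assms by (intro prod.mono_neutral_left) (auto simp: in_keys_iff)

lemma mono_fact_add_single:
  "mono_fact (a + single v 1) = mono_fact a * Suc (lookup a v)"
proof -
  let ?A = "insert v (keys a)"
  have "mono_fact (a + single v 1) = (\<Prod>u\<in>?A. fact (lookup (a + single v 1) u))"
    by (rule mono_fact_superset) (auto simp: keys_add_monomial)
  also have "\<dots> = fact (Suc (lookup a v)) * (\<Prod>u\<in>?A - {v}. fact (lookup (a + single v 1) u))"
    by (subst prod.remove[of _ v]) (auto simp: lookup_add)
  also have "(\<Prod>u\<in>?A - {v}. fact (lookup (a + single v 1) u)) = (\<Prod>u\<in>?A - {v}. fact (lookup a u))"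
    by (rule prod.cong) (auto simp: lookup_add lookup_single when_def)
  also have "fact (Suc (lookup a v)) * \<dots> = Suc (lookup a v) * (\<Prod>u\<in>?A. fact (lookup a u))"
    by (subst (2) prod.remove[of _ v]) (auto simp: algebra_simps)
  also have "(\<Prod>u\<in>?A. fact (lookup a u)) = mono_fact a"
    by (rule mono_fact_superset[symmetric]) auto
  finally show ?thesis by simp
qed

lemma mono_fact_remove:
  assumes "v \<in> keys a"
  shows "mono_fact a = mono_fact (a - single v 1) * lookup a v"
proof -
  have "Suc (lookup (a - single v 1) v) = lookup a v"
    using assms by (simp add: lookup_minus in_keys_iff)
  then show ?thesis
    using mono_fact_add_single[of "a - single v 1" v] by (simp only: monomial_split_key[OF assms])
qed

lemma multinomial_factor_altdef:
  "multinomial_factor \<mu> = mono_fact (row_exponent \<mu>) div mono_fact \<mu>"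
  by (simp add: multinomial_factor_def mono_fact_def)

lemma row_exponent_remove:
  assumes "(l, s) \<in> keys \<mu>"
  shows "row_exponent (\<mu> - single (l, s) 1) = row_exponent \<mu> - single l 1"
    and "row_exponent \<mu> = row_exponent (\<mu> - single (l, s) 1) + single l 1"
    and "l \<in> keys (row_exponent \<mu>)"
proof -
  show *: "row_exponent \<mu> = row_exponent (\<mu> - single (l, s) 1) + single l 1"
    using arg_cong[OF monomial_split_key[OF assms], of row_exponent] by simp
  then show "row_exponent (\<mu> - single (l, s) 1) = row_exponent \<mu> - single l 1"
    by simp
  show "l \<in> keys (row_exponent \<mu>)"
    by (subst *) (auto simp: keys_add_monomial)
qed

text \<open>Pascal's rule multiplied by the factorials. Removing one factor \<open>(l, s)\<close>
  divides \<open>mono_fact \<mu>\<close> by the exponent of \<open>(l, s)\<close>, and the exponents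
  in row \<open>l\<close> add up to the exponent of \<open>l\<close> in
  \<open>row_exponent \<mu>\<close>. \<open>IH\<close> is a hypothesis because the lemma serves
  twice: inside the induction that establishes it, and afterwards for Pascal's rule itself.\<close>

lemma sum_multinomial_times_fact:
  assumes l: "l \<in> keys (row_exponent \<mu>)"
    and IH: "\<And>s. (l, s) \<in> keys \<mu> \<Longrightarrow> multinomial_factor (\<mu> - single (l, s) 1)
      * mono_fact (\<mu> - single (l, s) 1) = mono_fact (row_exponent (\<mu> - single (l, s) 1))"
  shows "(\<Sum>s | (l, s) \<in> keys \<mu>. multinomial_factor (\<mu> - single (l, s) 1)) * mono_fact \<mu>
    = mono_fact (row_exponent \<mu>)"
proof -
  have "(\<Sum>s | (l, s) \<in> keys \<mu>. multinomial_factor (\<mu> - single (l, s) 1)) * mono_fact \<mu>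
    = (\<Sum>s | (l, s) \<in> keys \<mu>. mono_fact (row_exponent \<mu> - single l 1) * lookup \<mu> (l, s))"
    unfolding sum_distrib_right
  proof (rule sum.cong)
    fix s assume "s \<in> {s. (l, s) \<in> keys \<mu>}"
    then have s: "(l, s) \<in> keys \<mu>" by simp
    show "multinomial_factor (\<mu> - single (l, s) 1) * mono_fact \<mu>
      = mono_fact (row_exponent \<mu> - single l 1) * lookup \<mu> (l, s)"
      unfolding row_exponent_remove(1)[OF s, symmetric] IH[OF s, symmetric] mono_fact_remove[OF s]
      by (simp only: ac_simps)
  qed simp
  also have "\<dots> = mono_fact (row_exponent \<mu> - single l 1) * lookup (row_exponent \<mu>) l"
    by (simp add: lookup_row_exponent sum_distrib_left)
  also have "\<dots> = mono_fact (row_exponent \<mu>)"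
    by (rule mono_fact_remove[OF l, symmetric])
  finally show ?thesis .
qed

text \<open>The point is that the \<open>div\<close> in \<open>multinomial_factor\<close> leaves no
  remainder. This goes by induction on the degree.\<close>

lemma multinomial_factor_times_fact:
  "multinomial_factor \<mu> * mono_fact \<mu> = mono_fact (row_exponent \<mu>)"
proof (induction "mdeg \<mu>" arbitrary: \<mu> rule: less_induct)
  case less
  show ?case
  proof (cases "\<mu> = 0")
    case True
    then show ?thesis by (simp add: multinomial_factor_altdef mono_fact_def)
  next
    case False
    then have "keys (row_exponent \<mu>) \<noteq> {}"
      by (metis keys_eq_empty row_exponent_eq_0_iff)
    then obtain l where l: "l \<in> keys (row_exponent \<mu>)" by blast
    \<comment> \<open>The cofactor is the sum of the smaller multinomial factors, a natural number
      by construction.\<close>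
    have "mono_fact \<mu> dvd mono_fact (row_exponent \<mu>)"
    proof (rule dvdI)
      show "mono_fact (row_exponent \<mu>) = mono_fact \<mu>
        * (\<Sum>s | (l, s) \<in> keys \<mu>. multinomial_factor (\<mu> - single (l, s) 1))"
      proof (subst mult.commute, rule sum_multinomial_times_fact[OF l, symmetric])
        fix s assume "(l, s) \<in> keys \<mu>"
        then have "mdeg (\<mu> - single (l, s) 1) < mdeg \<mu>"
          using arg_cong[OF monomial_split_key, of "(l, s)" \<mu> mdeg] by simp
        then show "multinomial_factor (\<mu> - single (l, s) 1) * mono_fact (\<mu> - single (l, s) 1)
            = mono_fact (row_exponent (\<mu> - single (l, s) 1))"
          by (rule less)
      qed
    qed
    then show ?thesis by (simp add: multinomial_factor_altdef)
  qed
qed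

text \<open>Both sides agree after multiplication by \<open>mono_fact \<mu>\<close>, which is
  positive and cancels.\<close>

lemma multinomial_factor_pascal:
  assumes "l \<in> keys (row_exponent \<mu>)"
  shows "multinomial_factor \<mu> = (\<Sum>s | (l, s) \<in> keys \<mu>. multinomial_factor (\<mu> - single (l, s) 1))"
proof -
  have "multinomial_factor \<mu> * mono_fact \<mu>
    = (\<Sum>s | (l, s) \<in> keys \<mu>. multinomial_factor (\<mu> - single (l, s) 1)) * mono_fact \<mu>"
    using sum_multinomial_times_fact[OF assms multinomial_factor_times_fact]
      multinomial_factor_times_fact[of \<mu>] by (rule trans[OF _ sym, rotated])
  then show ?thesis using mono_fact_pos[of \<mu>] by simp
qed

lemma multinomial_factor_zero [simp]: "multinomial_factor 0 = 1"
  by (simp add: multinomial_factor_altdef mono_fact_def)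

text \<open>These are the coefficients of the monomial \<open>\<mu>\<close> on both sides of
  \<open>Y^p * Y^q = Y^(p + q)\<close>. Fixing the row exponents of \<open>b\<close> as
  \<open>p\<close> forces those of \<open>c\<close> to be \<open>q\<close>. The induction removes
  one variable of row \<open>l\<close> from \<open>p\<close>, with Pascal's rule applied to
  \<open>b\<close> and, backwards, to \<open>\<mu>\<close>.\<close>

lemma multinomial_factor_vandermonde:
  assumes "p + q = row_exponent \<mu>"
  shows "(\<Sum>(b, c)\<in>{(b, c) \<in> splits \<mu>. row_exponent b = p}.
      multinomial_factor b * multinomial_factor c) = multinomial_factor \<mu>"
  using assms
proof (induction "mdeg p" arbitrary: p \<mu>)
  case 0
  then have "{(b, c) \<in> splits \<mu>. row_exponent b = p} = {(0, \<mu>)}" by auto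
  then show ?case by simp
next
  case (Suc n)
  then have "p \<noteq> 0" by auto
  then obtain l where l: "l \<in> keys p" using keys_eq_empty by blast
  define p' where "p' = p - single l 1"
  have p: "p = p' + single l 1"
    using monomial_split_key[OF l] by (simp add: p'_def)
  have deg: "n = mdeg p'" using Suc(2) p by simp
  have l\<mu>: "l \<in> keys (row_exponent \<mu>)"
    using Suc.prems[symmetric] l by (simp add: keys_add_monomial)
  let ?mf = multinomial_factor
  have fin: "finite {s. (l, s) \<in> keys \<nu>}" for \<nu> :: "(nat \<times> nat) monomial"
    by (rule finite_subset[of _ "snd ` keys \<nu>"]) force+
  have finS: "finite {(b, c). (b, c) \<in> splits \<nu> \<and> row_exponent b = r}" for \<nu> r
    by (rule finite_subset[OF _ finite_splits[of \<nu>]]) auto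
  have "(\<Sum>(b, c)\<in>{(b, c) \<in> splits \<mu>. row_exponent b = p}. ?mf b * ?mf c)
    = (\<Sum>(b, c)\<in>{(b, c) \<in> splits \<mu>. row_exponent b = p}.
        \<Sum>s | (l, s) \<in> keys b. ?mf (b - single (l, s) 1) * ?mf c)"
    by (intro sum.cong refl)
      (auto simp: multinomial_factor_pascal[of l] l sum_distrib_right case_prod_unfold)
  also have "\<dots> = (\<Sum>((b, c), s)\<in>Sigma {(b, c) \<in> splits \<mu>. row_exponent b = p}
        (\<lambda>(b, c). {s. (l, s) \<in> keys b}). ?mf (b - single (l, s) 1) * ?mf c)"
    using fin finS by (subst sum.Sigma[symmetric]) (auto simp: case_prod_unfold simp del: splits_iff)
  \<comment> \<open>Choosing a splitting and then a variable \<open>(l, s)\<close> of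
    \<open>b\<close> amounts to choosing \<open>(l, s)\<close> in \<open>\<mu>\<close> first and
    splitting what remains.\<close>
  also have "\<dots> = (\<Sum>(s, (b, c))\<in>Sigma {s. (l, s) \<in> keys \<mu>}
        (\<lambda>s. {(b, c) \<in> splits (\<mu> - single (l, s) 1). row_exponent b = p'}). ?mf b * ?mf c)"
  proof (rule sum.reindex_bij_witness[of _ "\<lambda>(s, (b, c)). ((b + single (l, s) 1, c), s)"
        "\<lambda>((b, c), s). (s, (b - single (l, s) 1, c))"], goal_cases)
    case (1 x)
    then obtain b c s where x: "x = ((b, c), s)" "(l, s) \<in> keys b"
      by (cases x) auto
    show ?case using monomial_split_key[OF x(2)] by (simp add: x(1))
  next
    case (2 x)
    then obtain b c s where x: "x = ((b, c), s)" "b + c = \<mu>" "row_exponent b = p" "(l, s) \<in> keys b"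
      by (cases x) auto
    have b: "b = b - single (l, s) 1 + single (l, s) 1"
      by (rule monomial_split_key[OF x(4), symmetric])
    have "(l, s) \<in> keys \<mu>" using x(4) by (simp add: keys_add_monomial flip: x(2))
    moreover have "\<mu> = b - single (l, s) 1 + c + single (l, s) 1"
      by (subst x(2)[symmetric], subst b) (simp only: ac_simps)
    then have "b - single (l, s) 1 + c = \<mu> - single (l, s) 1" by simp
    moreover have "row_exponent (b - single (l, s) 1) = p'"
      using row_exponent_remove(1)[OF x(4)] x(3) by (simp add: p'_def)
    ultimately show ?case by (simp add: x(1))
  next
    case (3 y)
    obtain s b c where "y = (s, (b, c))" by (cases y) auto
    then show ?case by simp
  next
    case (4 y)
    then obtain s b c where y: "y = (s, (b, c))" "b + c = \<mu> - single (l, s) 1"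
      "row_exponent b = p'" "(l, s) \<in> keys \<mu>"
      by (cases y) auto
    have "b + single (l, s) 1 + c = b + c + single (l, s) 1"
      by (simp only: ac_simps)
    also have "\<dots> = \<mu>"
      using monomial_split_key[OF y(4)] by (simp only: y(2))
    finally have "b + single (l, s) 1 + c = \<mu>" .
    then show ?case using y(3) p by (simp add: y(1) keys_add_monomial)
  next
    case (5 x)
    obtain b c s where "x = ((b, c), s)" by (cases x) auto
    then show ?case by simp
  qed
  also have "\<dots> = (\<Sum>s | (l, s) \<in> keys \<mu>. \<Sum>(b, c)\<in>{(b, c) \<in> splits (\<mu> - single (l, s) 1).
        row_exponent b = p'}. ?mf b * ?mf c)"
    using fin finS by (subst sum.Sigma[symmetric]) (auto simp del: splits_iff)
  also have "\<dots> = (\<Sum>s | (l, s) \<in> keys \<mu>. ?mf (\<mu> - single (l, s) 1))"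
  proof (intro sum.cong refl Suc.hyps(1))
    fix s assume "s \<in> {s. (l, s) \<in> keys \<mu>}"
    then have "row_exponent \<mu> = row_exponent (\<mu> - single (l, s) 1) + single l 1"
      by (intro row_exponent_remove) simp
    moreover have "row_exponent \<mu> = p' + q + single l 1"
      unfolding Suc.prems[symmetric] p by (simp only: ac_simps)
    ultimately show "p' + q = row_exponent (\<mu> - single (l, s) 1)" by simp
  qed (rule deg)
  also have "\<dots> = ?mf \<mu>" by (rule multinomial_factor_pascal[OF l\<mu>, symmetric])
  finally show ?case .
qed

section \<open>Power series and the order filtration\<close>

definition ps_mult :: "'k::comm_ring_1 power_series \<Rightarrow> 'k power_series \<Rightarrow> 'k power_series" where
  "ps_mult f g = (\<lambda>a. \<Sum>(b, c)\<in>splits a. f b * g c)"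

lemma power_series_carrier_iff:
  "f \<in> carrier (power_series_ring m) \<longleftrightarrow> (\<forall>a. f a \<noteq> 0 \<longrightarrow> keys a \<subseteq> {1..m})"
  by (simp add: power_series_ring_def)

lemma power_series_ring_simps [simp]:
  "f \<otimes>\<^bsub>power_series_ring m\<^esub> g = ps_mult f g"
  "\<one>\<^bsub>power_series_ring m\<^esub> = (\<lambda>a. if a = 0 then 1 else 0)"
  "\<zero>\<^bsub>power_series_ring m\<^esub> = (\<lambda>a. 0)"
  "f \<oplus>\<^bsub>power_series_ring m\<^esub> g = (\<lambda>a. f a + g a)"
  by (auto simp: power_series_ring_def ps_mult_def splits_def)

lemma ps_mult_commute: "ps_mult f g = ps_mult g f"
  unfolding ps_mult_def by (subst sum_splits_commute) (simp add: mult.commute)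

lemma ps_mult_assoc: "ps_mult (ps_mult f g) h = ps_mult f (ps_mult g h)"
proof
  fix a
  have "ps_mult (ps_mult f g) h a = (\<Sum>(p, c)\<in>splits a. \<Sum>(b, d)\<in>splits p. f b * g d * h c)"
    by (simp add: ps_mult_def sum_distrib_right case_prod_unfold)
  also have "\<dots> = (\<Sum>(b, q)\<in>splits a. \<Sum>(d, c)\<in>splits q. f b * g d * h c)"
    by (rule sum_splits_assoc)
  also have "\<dots> = ps_mult f (ps_mult g h) a"
    by (simp add: ps_mult_def sum_distrib_left case_prod_unfold mult.assoc)
  finally show "ps_mult (ps_mult f g) h a = ps_mult f (ps_mult g h) a" .
qed

lemma ps_mult_nonzeroE:
  assumes "ps_mult f g a \<noteq> 0"
  obtains b c where "b + c = a" "f b \<noteq> 0" "g c \<noteq> 0"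
proof -
  have "\<exists>x\<in>splits a. (case x of (b, c) \<Rightarrow> f b * g c) \<noteq> 0"
    using assms unfolding ps_mult_def by (meson sum.neutral)
  then obtain b c where "b + c = a" "f b * g c \<noteq> 0" by auto
  then show ?thesis using that by fastforce
qed

lemma ps_mult_monomial:
  "ps_mult f (\<lambda>c. if c = d then x else 0) (b + d) = f b * x"
proof -
  have "ps_mult f (\<lambda>c. if c = d then x else 0) (b + d)
    = (\<Sum>y\<in>splits (b + d). if y = (b, d) then f b * x else 0)"
    unfolding ps_mult_def by (rule sum.cong) (auto simp del: mult_eq_0_iff split: if_splits)
  then show ?thesis by simp
qed

lemma ps_mult_closed:
  assumes "f \<in> carrier (power_series_ring m)" "g \<in> carrier (power_series_ring m)"
  shows "ps_mult f g \<in> carrier (power_series_ring m)"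
  using assms by (fastforce simp: power_series_carrier_iff keys_add_monomial elim!: ps_mult_nonzeroE)

lemma ps_mult_var:
  "ps_mult f (ps_var i) a = (if i \<in> keys a then f (a - single i 1) else 0)"
proof (cases "i \<in> keys a")
  case True
  then show ?thesis
    using ps_mult_monomial[of f "single i 1" 1 "a - single i 1"]
    by (simp add: ps_var_def monomial_split_key del: One_nat_def)
next
  case False
  then show ?thesis
    by (auto simp: ps_var_def keys_add_monomial split: if_splits
        intro!: ccontr[of "ps_mult _ _ _ = 0"] elim!: ps_mult_nonzeroE)
qed

lemma ps_var_closed: "i \<in> {1..m} \<Longrightarrow> ps_var i \<in> carrier (power_series_ring m)"
  by (auto simp: ps_var_def power_series_carrier_iff)

lemma ps_const_closed: "ps_const c \<in> carrier (power_series_ring m)"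
  by (simp add: ps_const_def power_series_carrier_iff)

lemma ps_mult_add_left: "ps_mult (\<lambda>a. f a + g a) h = (\<lambda>a. ps_mult f h a + ps_mult g h a)"
  by (simp add: ps_mult_def sum.distrib case_prod_unfold algebra_simps)

lemma ps_mult_one: "ps_mult (\<lambda>a. if a = 0 then 1 else 0) f = f"
  using ps_mult_monomial[of f 0 1] by (subst ps_mult_commute) auto

lemma ps_add_closed:
  assumes "f \<in> carrier (power_series_ring m)" "g \<in> carrier (power_series_ring m)"
  shows "(\<lambda>a. f a + g a) \<in> carrier (power_series_ring m)"
  using assms unfolding power_series_carrier_iff by (metis add_0)

lemma ps_uminus_closed:
  "f \<in> carrier (power_series_ring m) \<Longrightarrow> (\<lambda>a. - f a) \<in> carrier (power_series_ring m)"
  by (simp add: power_series_carrier_iff)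

lemma ps_zero_closed: "(\<lambda>a. 0) \<in> carrier (power_series_ring m)"
  by (simp add: power_series_carrier_iff)

lemma ps_monomial_closed:
  "keys a \<subseteq> {1..m} \<Longrightarrow> (\<lambda>b. if b = a then c else 0) \<in> carrier (power_series_ring m)"
  by (simp add: power_series_carrier_iff)

lemmas ps_closed = ps_mult_closed ps_add_closed ps_uminus_closed ps_zero_closed
  ps_var_closed ps_const_closed ps_monomial_closed

lemma power_series_cring: "cring (power_series_ring m :: 'k::comm_ring_1 power_series ring)"
proof (intro cringI abelian_groupI comm_monoidI)
  fix f :: "'k power_series"
  assume "f \<in> carrier (power_series_ring m)"
  then show "\<exists>g\<in>carrier (power_series_ring m). g \<oplus>\<^bsub>power_series_ring m\<^esub> f = \<zero>\<^bsub>power_series_ring m\<^esub>"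
    by (intro bexI[of _ "\<lambda>a. - f a"]) (auto simp: ps_closed)
next
  fix f g :: "'k power_series"
  show "f \<otimes>\<^bsub>power_series_ring m\<^esub> g = g \<otimes>\<^bsub>power_series_ring m\<^esub> f"
    by (simp add: ps_mult_commute)
qed (simp_all add: ps_mult_assoc ps_mult_add_left ps_mult_one ac_simps ps_closed)

lemma power_series_a_inv:
  fixes f :: "'k::comm_ring_1 power_series"
  assumes "f \<in> carrier (power_series_ring m)"
  shows "\<ominus>\<^bsub>power_series_ring m\<^esub> f = (\<lambda>a. - f a)"
proof -
  interpret cring "power_series_ring m :: 'k power_series ring" by (rule power_series_cring)
  show ?thesis
    by (rule minus_equality[OF _ assms ps_uminus_closed[OF assms]]) simp
qed

text \<open>This will turn out to be the \<open>n\<close>-th power of the ideal of the variables,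
  described by coefficients.\<close>

definition ord_ideal :: "nat \<Rightarrow> nat \<Rightarrow> 'k::comm_ring_1 power_series set" where
  "ord_ideal m n = {f \<in> carrier (power_series_ring m). \<forall>a. mdeg a < n \<longrightarrow> f a = 0}"

lemma ps_var_ord_ideal:
  assumes "i \<in> {1..m}"
  shows "ps_var i \<in> ord_ideal m 1"
proof -
  have "single i 1 \<noteq> (0 :: nat monomial)" by (metis mdeg_single mdeg_zero zero_neq_one)
  then show ?thesis using ps_var_closed[OF assms] by (auto simp: ord_ideal_def ps_var_def)
qed

lemma ord_ideal_mult:
  assumes "f \<in> ord_ideal m n" "g \<in> ord_ideal m n'"
  shows "ps_mult f g \<in> ord_ideal m (n + n')"
proof -
  have "ps_mult f g a = 0" if "mdeg a < n + n'" for a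
  proof (rule ccontr)
    assume "ps_mult f g a \<noteq> 0"
    then obtain b c where "b + c = a" "f b \<noteq> 0" "g c \<noteq> 0" by (rule ps_mult_nonzeroE)
    with assms have "n \<le> mdeg b" "n' \<le> mdeg c" by (auto simp: ord_ideal_def not_less[symmetric])
    with \<open>b + c = a\<close> that show False by auto
  qed
  then show ?thesis using assms by (auto simp: ord_ideal_def ps_closed)
qed

lemma ord_ideal_add:
  "\<lbrakk>f \<in> ord_ideal m n; g \<in> ord_ideal m n\<rbrakk> \<Longrightarrow> (\<lambda>a. f a + g a) \<in> ord_ideal m n"
  by (auto simp: ord_ideal_def ps_closed)

lemma ord_ideal_0: "ord_ideal m 0 = carrier (power_series_ring m)"
  by (simp add: ord_ideal_def)

lemma ord_ideal_ideal: "ideal (ord_ideal m n) (power_series_ring m :: 'k::comm_ring_1 power_series ring)"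
proof -
  interpret cring "power_series_ring m :: 'k power_series ring" by (rule power_series_cring)
  have "subgroup (ord_ideal m n) (add_monoid (power_series_ring m :: 'k power_series ring))"
  proof (rule group.subgroupI[OF a_group])
    show "ord_ideal m n \<noteq> ({} :: 'k power_series set)"
      using ps_zero_closed by (auto simp: ord_ideal_def)
  next
    fix f :: "'k power_series" assume f: "f \<in> ord_ideal m n"
    then have "inv\<^bsub>add_monoid (power_series_ring m)\<^esub> f = (\<lambda>a. - f a)"
      using power_series_a_inv[of f m] by (simp add: ord_ideal_def a_inv_def)
    then show "inv\<^bsub>add_monoid (power_series_ring m)\<^esub> f \<in> ord_ideal m n"
      using f by (simp add: ord_ideal_def ps_closed)
    qed (simp_all add: ord_ideal_add, simp add: ord_ideal_def subsetI)
  moreover have "ps_mult f g \<in> ord_ideal m n" "ps_mult g f \<in> ord_ideal m n"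
    if "f \<in> ord_ideal m n" "g \<in> carrier (power_series_ring m)" for f g :: "'k power_series"
    using ord_ideal_mult[OF that(1), of g 0] that(2)
    by (simp_all add: ord_ideal_0 ps_mult_commute)
  ultimately show ?thesis
    by (intro idealI ring_axioms) auto
qed

text \<open>Splitting off one variable at a time writes a series of order \<open>n + 1\<close> as
  \<open>\<Sum>\<^sub>i g\<^sub>i x\<^sub>i\<close> with all \<open>g\<^sub>i\<close> of order \<open>n\<close>.\<close>

lemma ord_ideal_Suc_subset:
  fixes S :: "'k::comm_ring_1 power_series set"
  assumes zero: "(\<lambda>a. 0) \<in> S"
    and add: "\<And>f g. \<lbrakk>f \<in> S; g \<in> S\<rbrakk> \<Longrightarrow> (\<lambda>a. f a + g a) \<in> S"
    and mult: "\<And>g i. \<lbrakk>g \<in> ord_ideal m n; i \<in> {1..m}\<rbrakk> \<Longrightarrow> ps_mult g (ps_var i) \<in> S"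
  shows "ord_ideal m (Suc n) \<subseteq> S"
proof -
  \<comment> \<open>Generalised to a set \<open>A\<close> of variables that meets every monomial of
    \<open>f\<close>, for induction on \<open>A\<close>. The choice \<open>A = {1..m}\<close> covers
    all of \<open>ord_ideal m (Suc n)\<close>, whose members have no constant term.\<close>
  have "f \<in> S" if "finite A" "A \<subseteq> {1..m}" "f \<in> ord_ideal m (Suc n)" "\<forall>a. f a \<noteq> 0 \<longrightarrow> keys a \<inter> A \<noteq> {}"
    for A f
    using that
  proof (induction A arbitrary: f rule: finite_induct)
    case empty
    then have "f = (\<lambda>a. 0)" by auto
    then show ?case using zero by simp
  next
    case (insert i A)
    \<comment> \<open>\<open>g\<close> times the variable \<open>i\<close> is the part of
      \<open>f\<close> divisible by that variable. Every monomial of the remainder \<open>r\<close>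
      meets the smaller set \<open>A\<close>.\<close>
    define g where "g b = f (b + single i 1)" for b
    define r where "r a = (if i \<in> keys a then 0 else f a)" for a
    have "keys b \<subseteq> {1..m}" if "g b \<noteq> 0" for b
      using insert.prems(2) that keys_add_monomial[of b "single i 1"]
      unfolding ord_ideal_def g_def power_series_carrier_iff by blast
    then have "g \<in> ord_ideal m n"
      using insert.prems(2) by (auto simp: ord_ideal_def power_series_carrier_iff g_def)
    then have "ps_mult g (ps_var i) \<in> S" using insert.prems(1) mult by blast
    moreover have "r \<in> S"
      using insert.prems by (intro insert.IH) (auto simp: ord_ideal_def power_series_carrier_iff r_def split: if_splits)
    moreover have "f = (\<lambda>a. ps_mult g (ps_var i) a + r a)"
      by (auto simp: ps_mult_var r_def g_def monomial_split_key simp del: One_nat_def)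
    ultimately show ?case using add by metis
  qed
  from this[of "{1..m}"] show ?thesis
    by (auto simp: ord_ideal_def power_series_carrier_iff Int_absorb2)
      (metis keys_eq_empty mdeg_zero zero_less_Suc)
qed

lemma genideal_vars: "Idl\<^bsub>power_series_ring m\<^esub> (ps_var ` {1..m}) = (ord_ideal m 1 :: 'k::comm_ring_1 power_series set)"
proof
  interpret cring "power_series_ring m :: 'k power_series ring" by (rule power_series_cring)
  let ?I = "Idl\<^bsub>power_series_ring m\<^esub> (ps_var ` {1..m}) :: 'k power_series set"
  have vars: "ps_var ` {1..m} \<subseteq> carrier (power_series_ring m :: 'k power_series ring)"
    using ps_var_closed by blast
  interpret I: ideal ?I "power_series_ring m :: 'k power_series ring"
    by (rule genideal_ideal[OF vars])
  have "ord_ideal m (Suc 0) \<subseteq> ?I"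
  proof (rule ord_ideal_Suc_subset)
    show "(\<lambda>a. 0) \<in> ?I" using I.zero_closed by simp
    show "(\<lambda>a. f a + g a) \<in> ?I" if "f \<in> ?I" "g \<in> ?I" for f g using I.a_closed[OF that] by simp
    show "ps_mult g (ps_var i) \<in> ?I" if "g \<in> ord_ideal m 0" "i \<in> {1..m}" for g i
    proof -
      have "ps_var i \<in> ?I" using genideal_self[OF vars] that(2) by blast
      then show ?thesis using I.I_l_closed[of "ps_var i" g] that(1) by (simp add: ord_ideal_0)
    qed
  qed
  then show "ord_ideal m 1 \<subseteq> ?I" by simp
  show "?I \<subseteq> ord_ideal m 1"
    by (rule genideal_minimal[OF ord_ideal_ideal]) (auto simp only: ps_var_ord_ideal)
qed

text \<open>Orders add under multiplication, which gives one inclusion. For the other, the ideal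
  product takes the place of \<open>S\<close> in \<open>ord_ideal_Suc_subset\<close>.\<close>

lemma ord_ideal_prod:
  "ord_ideal m n \<cdot>\<^bsub>power_series_ring m\<^esub> ord_ideal m 1 = (ord_ideal m (Suc n) :: 'k::comm_ring_1 power_series set)"
proof
  let ?P = "ord_ideal m n \<cdot>\<^bsub>power_series_ring m\<^esub> ord_ideal m 1 :: 'k power_series set"
  show "?P \<subseteq> ord_ideal m (Suc n)"
  proof
    fix f assume "f \<in> ?P"
    then show "f \<in> ord_ideal m (Suc n)"
    proof (induction rule: ideal_prod.induct)
      case (prod f g)
      then show ?case using ord_ideal_mult[of f m n g 1] by simp
    next
      case (sum f g)
      then show ?case by (simp add: ord_ideal_add)
    qed
  qed
  show "ord_ideal m (Suc n) \<subseteq> ?P"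
  proof (rule ord_ideal_Suc_subset)
    have "ps_mult (\<lambda>a. 0) (\<lambda>a. 0 :: 'k) = (\<lambda>a. 0)" by (simp add: ps_mult_def case_prod_unfold)
    then show "(\<lambda>a. 0) \<in> ?P"
      using ideal_prod.prod[of "\<lambda>a. 0 :: 'k" "ord_ideal m n" "\<lambda>a. 0" "ord_ideal m 1" "power_series_ring m"]
      by (simp add: ord_ideal_def ps_closed)
    show "(\<lambda>a. f a + g a) \<in> ?P" if "f \<in> ?P" "g \<in> ?P" for f g
      using ideal_prod.sum[OF that] by simp
    show "ps_mult g (ps_var i) \<in> ?P" if "g \<in> ord_ideal m n" "i \<in> {1..m}" for g i
      using ideal_prod.prod[of g "ord_ideal m n" "ps_var i" "ord_ideal m 1" "power_series_ring m"] that ps_var_ord_ideal[of i m]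
      by simp
  qed
qed

lemma trunc_ideal_eq: "trunc_ideal m N = (ord_ideal m (Suc N) :: 'k::comm_ring_1 power_series set)"
proof -
  \<comment> \<open>The zeroth power in \<open>ideals_set\<close> is the whole ring, that is
    \<open>ord_ideal m 0\<close>, and each further factor raises the order by one.\<close>
  have "(ord_ideal m 1 :: 'k power_series set) [^]\<^bsub>ideals_set (power_series_ring m)\<^esub> n = ord_ideal m n" for n :: nat
    by (induction n) (simp_all add: nat_pow_def ideals_set_def ord_ideal_0 ord_ideal_prod[unfolded One_nat_def])
  from this[of "N + 1"] show ?thesis by (simp only: trunc_ideal_def Let_def genideal_vars Suc_eq_plus1)
qed

section \<open>The truncated power series ring\<close>

text \<open>Two series are congruent when their difference has order at least \<open>N + 1\<close>.
  With this, cosets can be handled through coefficients.\<close>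

lemma trunc_class_eq:
  fixes f :: "'k::comm_ring_1 power_series"
  assumes "f \<in> carrier (power_series_ring m)"
  shows "trunc_class m N f = {g \<in> carrier (power_series_ring m). \<forall>a. mdeg a \<le> N \<longrightarrow> g a = f a}"
proof (intro equalityI subsetI)
  fix g assume g: "g \<in> trunc_class m N f"
  obtain h where "h \<in> ord_ideal m (Suc N)" "g = (\<lambda>a. h a + f a)"
    using g unfolding trunc_class_def trunc_ideal_eq by (auto simp: a_r_coset_def')
  then show "g \<in> {g \<in> carrier (power_series_ring m). \<forall>a. mdeg a \<le> N \<longrightarrow> g a = f a}"
    using assms ps_add_closed[of h m f]
    by (auto simp: ord_ideal_def less_Suc_eq_le)
next
  fix g assume g: "g \<in> {g \<in> carrier (power_series_ring m). \<forall>a. mdeg a \<le> N \<longrightarrow> g a = f a}"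
  have "(\<lambda>a. g a + - f a) \<in> ord_ideal m (Suc N)"
    using g assms ps_add_closed[OF _ ps_uminus_closed[OF assms], of g]
    by (auto simp: ord_ideal_def less_Suc_eq_le)
  moreover have "g = (\<lambda>a. g a + - f a) \<oplus>\<^bsub>power_series_ring m\<^esub> f" by auto
  ultimately show "g \<in> trunc_class m N f"
    unfolding trunc_class_def trunc_ideal_eq a_r_coset_def' by blast
qed

lemma trunc_class_eq_iff:
  fixes f g :: "'k::comm_ring_1 power_series"
  assumes "f \<in> carrier (power_series_ring m)" "g \<in> carrier (power_series_ring m)"
  shows "trunc_class m N f = trunc_class m N g \<longleftrightarrow> (\<forall>a. mdeg a \<le> N \<longrightarrow> f a = g a)"
  using assms by (auto simp: trunc_class_eq)

lemma trunc_coeff_class: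
  fixes f :: "'k::comm_ring_1 power_series"
  assumes "f \<in> carrier (power_series_ring m)" "mdeg a \<le> N"
  shows "trunc_coeff (trunc_class m N f) a = f a"
  unfolding trunc_coeff_def trunc_class_eq[OF assms(1)] using assms
  by (intro the_equality) (auto)

lemma trunc_ring_ring: "ring (trunc_ring m N :: 'k::comm_ring_1 power_series set ring)"
  unfolding trunc_ring_def trunc_ideal_eq by (rule ideal.quotient_is_ring[OF ord_ideal_ideal])

lemma trunc_ring_carrier:
  "carrier (trunc_ring m N) = trunc_class m N ` carrier (power_series_ring m)"
  by (auto simp: trunc_ring_def FactRing_def A_RCOSETS_def RCOSETS_def trunc_class_def a_r_coset_def)

lemma trunc_class_hom:
  "trunc_class m N \<in> ring_hom (power_series_ring m) (trunc_ring m N :: 'k::comm_ring_1 power_series set ring)"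
proof -
  have "(+>\<^bsub>power_series_ring m\<^esub>) (trunc_ideal m N) = (trunc_class m N :: 'k power_series \<Rightarrow> _)"
    by (auto simp: trunc_class_def)
  then show ?thesis
    using ideal.rcos_ring_hom[OF ord_ideal_ideal[of m "Suc N", where 'k = 'k]]
    unfolding trunc_ring_def trunc_ideal_eq by simp
qed

text \<open>Modulo the ideal every series is a polynomial, so constants and variables generate the
  ring. Identities between homomorphisms can therefore be checked on them.\<close>

lemma trunc_ring_induct [consumes 1, case_names const var add mult]:
  fixes C :: "'k::comm_ring_1 power_series set"
  assumes C: "C \<in> carrier (trunc_ring m N)"
    and const: "\<And>c. P (trunc_class m N (ps_const c))"
    and var: "\<And>i. i \<in> {1..m} \<Longrightarrow> P (trunc_class m N (ps_var i))"
    and add: "\<And>C D. \<lbrakk>C \<in> carrier (trunc_ring m N); D \<in> carrier (trunc_ring m N); P C; P D\<rbrakk>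
      \<Longrightarrow> P (C \<oplus>\<^bsub>trunc_ring m N\<^esub> D)"
    and mult: "\<And>C D. \<lbrakk>C \<in> carrier (trunc_ring m N); D \<in> carrier (trunc_ring m N); P C; P D\<rbrakk>
      \<Longrightarrow> P (C \<otimes>\<^bsub>trunc_ring m N\<^esub> D)"
  shows "P C"
proof -
  let ?R = "power_series_ring m :: 'k power_series ring"
  let ?cl = "trunc_class m N :: 'k power_series \<Rightarrow> _"
  have add': "P (?cl (\<lambda>a. f a + g a))" if "f \<in> carrier ?R" "g \<in> carrier ?R" "P (?cl f)" "P (?cl g)" for f g
    using add[of "?cl f" "?cl g"] ring_hom_add[OF trunc_class_hom that(1,2)] that
    by (simp add: trunc_ring_carrier)
  have mult': "P (?cl (ps_mult f g))" if "f \<in> carrier ?R" "g \<in> carrier ?R" "P (?cl f)" "P (?cl g)" for f g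
    using mult[of "?cl f" "?cl g"] ring_hom_mult[OF trunc_class_hom that(1,2)] that
    by (simp add: trunc_ring_carrier)
  have mono: "P (?cl (\<lambda>b. if b = a then c else 0))" if "keys a \<subseteq> {1..m}" for a c
    using that
  proof (induction "mdeg a" arbitrary: a)
    case 0
    then show ?case using const[of c] by (simp add: ps_const_def)
  next
    case (Suc n)
    then have "keys a \<noteq> {}" by auto
    then obtain i where i: "i \<in> keys a" by blast
    define a' where "a' = a - single i 1"
    have a: "a = a' + single i 1" using monomial_split_key[OF i] by (simp add: a'_def)
    have "ps_mult (\<lambda>b. if b = a' then c else 0) (ps_var i) = (\<lambda>b. if b = a then c else 0)"
    proof
      fix b show "ps_mult (\<lambda>b. if b = a' then c else 0) (ps_var i) b = (if b = a then c else 0)"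
        using monomial_split_key[of i b] a'_def i unfolding ps_mult_var by (auto simp: a)
    qed
    moreover have "P (?cl (\<lambda>b. if b = a' then c else 0))"
      using Suc a by (auto simp: keys_add_monomial)
    moreover have "i \<in> {1..m}" "keys a' \<subseteq> {1..m}"
      using Suc.prems a by (auto simp: keys_add_monomial)
    ultimately show ?case
      using mult'[OF ps_monomial_closed[of a' m c] ps_var_closed[of i m]] var by simp
  qed
  obtain f where f: "f \<in> carrier ?R" "C = ?cl f" using C by (auto simp: trunc_ring_carrier)
  have fin: "P (?cl (\<lambda>b. if b \<in> A then f b else 0))" if "finite A" for A
    using that
  proof (induction A)
    case empty
    then show ?case using const[of 0] by (simp add: ps_const_def)
  next
    case (insert a A)
    show ?case
    proof (cases "keys a \<subseteq> {1..m}")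
      case True
      have "P (?cl (\<lambda>b. (if b \<in> A then f b else 0) + (if b = a then f a else 0)))"
        using f True by (intro add' insert.IH mono) (auto simp: power_series_carrier_iff)
      moreover have "(\<lambda>b. if b \<in> insert a A then f b else 0)
          = (\<lambda>b. (if b \<in> A then f b else 0) + (if b = a then f a else 0))"
        using insert.hyps by auto
      ultimately show ?thesis by simp
    next
      case False
      then have "f a = 0" using f by (auto simp: power_series_carrier_iff)
      then have "(\<lambda>b. if b \<in> insert a A then f b else 0) = (\<lambda>b. if b \<in> A then f b else 0)" by auto
      then show ?thesis using insert.IH by simp
    qed
  qed
  \<comment> \<open>A finite box of exponents that contains all monomials of degree at most
    \<open>N\<close> in the given variables. Cutting \<open>f\<close> down to it does not change the
    class.\<close>
  let ?A = "{a. keys a \<subseteq> {1..m} \<and> (\<forall>v. lookup a v \<le> N)}"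
  have "C = ?cl (\<lambda>b. if b \<in> ?A then f b else 0)"
    unfolding f(2) using f(1)
    by (subst trunc_class_eq_iff)
      (auto simp: power_series_carrier_iff intro: order_trans[OF lookup_le_mdeg])
  then show ?thesis using fin[OF finite_bounded_monomials[of "{1..m}" N]] by simp
qed

section \<open>Polynomial rings and substitution\<close>

lemma poly_ring_carrier_iff:
  "p \<in> carrier (poly_ring V) \<longleftrightarrow> (\<forall>a\<in>keys p. keys a \<subseteq> V)"
  by (simp add: poly_ring_def)

lemma poly_ring_simps [simp]:
  "p \<otimes>\<^bsub>poly_ring V\<^esub> q = p * q"
  "p \<oplus>\<^bsub>poly_ring V\<^esub> q = p + q"
  "\<one>\<^bsub>poly_ring V\<^esub> = 1"
  "\<zero>\<^bsub>poly_ring V\<^esub> = 0"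
  by (simp_all add: poly_ring_def)

lemma poly_add_closed:
  assumes "p \<in> carrier (poly_ring V)" "q \<in> carrier (poly_ring V)"
  shows "p + q \<in> carrier (poly_ring V)"
  using assms keys_add[of p q] unfolding poly_ring_carrier_iff by blast

lemma poly_mult_closed:
  assumes "p \<in> carrier (poly_ring V)" "q \<in> carrier (poly_ring V)"
  shows "p * q \<in> carrier (poly_ring V)"
  unfolding poly_ring_carrier_iff
proof
  fix a assume "a \<in> keys (p * q)"
  then obtain b c where "a = b + c" "b \<in> keys p" "c \<in> keys q"
    using keys_mult[of p q] by blast
  then show "keys a \<subseteq> V"
    using assms by (auto simp: poly_ring_carrier_iff keys_add_monomial)
qed

lemma poly_const_closed: "poly_const c \<in> carrier (poly_ring V)"
  by (simp add: poly_ring_carrier_iff poly_const_def)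

lemma poly_var_closed: "v \<in> V \<Longrightarrow> poly_var v \<in> carrier (poly_ring V)"
  by (simp add: poly_ring_carrier_iff poly_var_def)

lemma poly_one_closed: "1 \<in> carrier (poly_ring V)"
  using poly_const_closed[of 1] by (simp add: poly_const_def)

lemma poly_zero_closed: "0 \<in> carrier (poly_ring V)"
  by (simp add: poly_ring_carrier_iff)

lemma poly_uminus_closed: "p \<in> carrier (poly_ring V) \<Longrightarrow> - p \<in> carrier (poly_ring V)"
  by (simp add: poly_ring_carrier_iff)

lemmas poly_closed = poly_add_closed poly_mult_closed poly_const_closed poly_var_closed
  poly_one_closed poly_zero_closed poly_uminus_closed

lemma poly_ring_ring: "ring (poly_ring V :: ('x, 'k::comm_ring_1) polynomial ring)"
proof (intro ringI abelian_groupI monoidI)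
  fix p :: "('x, 'k) polynomial"
  assume "p \<in> carrier (poly_ring V)"
  then show "\<exists>q\<in>carrier (poly_ring V). q \<oplus>\<^bsub>poly_ring V\<^esub> p = \<zero>\<^bsub>poly_ring V\<^esub>"
    by (intro bexI[of _ "- p"]) (simp_all add: poly_closed)
qed (simp_all add: poly_closed algebra_simps)

section \<open>Substitution of polynomials for variables\<close>

definition mono_subst :: "('x \<Rightarrow> ('y, 'k::comm_ring_1) polynomial) \<Rightarrow> 'x monomial \<Rightarrow> ('y, 'k) polynomial" where
  "mono_subst P a = (\<Prod>v\<in>keys a. P v ^ lookup a v)"

definition poly_subst ::
    "('x \<Rightarrow> ('y, 'k::comm_ring_1) polynomial) \<Rightarrow> ('x, 'k) polynomial \<Rightarrow> ('y, 'k) polynomial" where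
  "poly_subst P p = (\<Sum>a\<in>keys p. poly_const (lookup p a) * mono_subst P a)"

lemma poly_const_add: "poly_const (c + d) = poly_const c + poly_const d"
  by (simp add: poly_const_def single_add)

lemma poly_const_mult: "poly_const (c * d) = poly_const c * poly_const d"
  by (simp add: poly_const_def mult_single)

lemma poly_const_zero [simp]: "poly_const 0 = 0"
  by (simp add: poly_const_def)

lemma poly_const_one [simp]: "poly_const 1 = 1"
  by (simp add: poly_const_def)

lemma mono_subst_superset:
  assumes "finite A" "keys a \<subseteq> A"
  shows "mono_subst P a = (\<Prod>v\<in>A. P v ^ lookup a v)"
  unfolding mono_subst_def using assms by (intro prod.mono_neutral_left) (auto simp: in_keys_iff)

lemma mono_subst_add: "mono_subst P (a + b) = mono_subst P a * mono_subst P b"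
proof -
  have "mono_subst P c = (\<Prod>v\<in>keys (a + b). P v ^ lookup c v)" if "c \<in> {a, b}" for c
    using that by (intro mono_subst_superset) (auto simp: keys_add_monomial)
  then show ?thesis
    by (simp add: mono_subst_def[of P "a + b"] lookup_add power_add prod.distrib)
qed

lemma poly_subst_superset:
  assumes "finite A" "keys p \<subseteq> A"
  shows "poly_subst P p = (\<Sum>a\<in>A. poly_const (lookup p a) * mono_subst P a)"
  unfolding poly_subst_def using assms by (intro sum.mono_neutral_left) (auto simp: in_keys_iff)

lemma poly_subst_add: "poly_subst P (p + q) = poly_subst P p + poly_subst P q"
proof -
  let ?A = "keys p \<union> keys q"
  have "poly_subst P r = (\<Sum>a\<in>?A. poly_const (lookup r a) * mono_subst P a)" if "r \<in> {p, q, p + q}" for r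
    using that keys_add[of p q] by (intro poly_subst_superset) auto
  then show ?thesis
    by (simp add: lookup_add poly_const_add algebra_simps sum.distrib)
qed

lemma poly_subst_zero [simp]: "poly_subst P 0 = 0"
  by (simp add: poly_subst_def)

lemma poly_subst_sum: "poly_subst P (sum f A) = (\<Sum>x\<in>A. poly_subst P (f x))"
  by (induction A rule: infinite_finite_induct) (simp_all add: poly_subst_add)

lemma poly_subst_single: "poly_subst P (single a c) = poly_const c * mono_subst P a"
  by (cases "c = 0") (simp_all add: poly_subst_def)

lemma poly_sum_singles: "p = (\<Sum>a\<in>keys p. single a (lookup p a))"
  by (rule poly_mapping_eqI)
    (auto simp: lookup_sum lookup_single when_def in_keys_iff)

text \<open>Bilinearity reduces the claim to single terms, where \<open>mono_subst\<close> turns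
  sums of exponents into products.\<close>

lemma poly_subst_mult: "poly_subst P (p * q) = poly_subst P p * poly_subst P q"
proof -
  have "p * q = (\<Sum>a\<in>keys p. \<Sum>b\<in>keys q. single a (lookup p a) * single b (lookup q b))"
    by (rule trans[OF arg_cong2[where f = "(*)", OF poly_sum_singles poly_sum_singles] sum_product])
  then have "poly_subst P (p * q)
    = (\<Sum>a\<in>keys p. \<Sum>b\<in>keys q. poly_subst P (single a (lookup p a)) * poly_subst P (single b (lookup q b)))"
    by (simp add: poly_subst_sum mult_single poly_subst_single mono_subst_add poly_const_mult ac_simps)
  also have "\<dots> = poly_subst P p * poly_subst P q"
    unfolding poly_subst_single by (simp add: poly_subst_def flip: sum_product)
  finally show ?thesis .
qed

lemma poly_subst_const [simp]: "poly_subst P (poly_const c) = poly_const c"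
  unfolding poly_const_def[of c] poly_subst_single by (simp add: mono_subst_def poly_const_def)

lemma poly_subst_one [simp]: "poly_subst P 1 = 1"
  using poly_subst_const[of P 1] by simp

lemma poly_subst_var [simp]: "poly_subst P (poly_var v) = P v"
  unfolding poly_var_def poly_subst_single by (simp add: mono_subst_def)

lemma poly_ring_induct [consumes 1, case_names const var add mult]:
  fixes p :: "('x, 'k::comm_ring_1) polynomial"
  assumes p: "p \<in> carrier (poly_ring V)"
    and const: "\<And>c. Q (poly_const c)"
    and var: "\<And>v. v \<in> V \<Longrightarrow> Q (poly_var v)"
    and add: "\<And>p q. \<lbrakk>Q p; Q q\<rbrakk> \<Longrightarrow> Q (p + q)"
    and mult: "\<And>p q. \<lbrakk>Q p; Q q\<rbrakk> \<Longrightarrow> Q (p * q)"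
  shows "Q p"
proof -
  have single: "Q (single a c)" if "keys a \<subseteq> V" for a c
    using that
  proof (induction "mdeg a" arbitrary: a)
    case 0
    then show ?case using const[of c] by (simp add: poly_const_def)
  next
    case (Suc n)
    then have "keys a \<noteq> {}" by auto
    then obtain v where v: "v \<in> keys a" by blast
    define b where "b = a - single v 1"
    have a: "a = b + single v 1" using monomial_split_key[OF v] by (simp add: b_def)
    have "Q (single b c)" using Suc a by (auto simp: keys_add_monomial)
    moreover have "Q (poly_var v)" using Suc.prems v by (auto intro: var)
    moreover have "single a c = single b c * poly_var v"
      by (simp add: a poly_var_def mult_single)
    ultimately show ?case using mult by simp
  qed
  have "Q (\<Sum>a\<in>A. single a (lookup p a))" if "finite A" "A \<subseteq> keys p" for A
    using that
  proof (induction A)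
    case empty
    then show ?case using const[of 0] by simp
  next
    case (insert a A)
    then have "keys a \<subseteq> V" using p by (auto simp: poly_ring_carrier_iff)
    then show ?case using insert by (auto intro!: add single)
  qed
  from this[of "keys p"] have "Q (\<Sum>a\<in>keys p. single a (lookup p a))" by simp
  then show ?thesis by (simp only: poly_sum_singles[symmetric])
qed

lemma poly_subst_closed:
  assumes "\<And>v. v \<in> V \<Longrightarrow> P v \<in> carrier (poly_ring W)" and "p \<in> carrier (poly_ring V)"
  shows "poly_subst P p \<in> carrier (poly_ring W)"
  using assms(2)
  by (induction rule: poly_ring_induct) (simp_all add: assms(1) poly_closed poly_subst_add poly_subst_mult)

section \<open>Coefficients along the universal curve\<close>

text \<open>\<open>jet m N j f\<close> is the coefficient of \<open>t\<^sup>j\<close> in \<open>f(Y\<^sub>1, \<dots>, Y\<^sub>m)\<close>, with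
  \<open>Y\<^sub>l = \<Sum>\<^sub>s y\<^sub>l\<^sub>s t\<^sup>s\<close>.\<close>

definition jet :: "nat \<Rightarrow> nat \<Rightarrow> nat \<Rightarrow> 'k::comm_ring_1 power_series \<Rightarrow> (nat \<times> nat, 'k) polynomial" where
  "jet m N j f = Abs_poly_mapping (\<lambda>\<mu>. if keys \<mu> \<subseteq> {1..m} \<times> {1..N}
    then of_nat (universal_factor j \<mu>) * f (row_exponent \<mu>) else 0)"

text \<open>Each variable \<open>(l, s)\<close> contributes \<open>s \<ge> 1\<close> to the weight.
  This bounds the support and the degree of a jet, and the degree up to which it depends on the
  series.\<close>

lemma mdeg_le_weight:
  assumes "keys \<mu> \<subseteq> {1..m} \<times> {1..N}"
  shows "mdeg \<mu> \<le> weight \<mu>"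
  unfolding mdeg_def weight_def using assms by (intro sum_mono) auto

text \<open>\<open>Abs_poly_mapping\<close> can be undone once the support is finite. It is, because
  weight \<open>j\<close> bounds every exponent by \<open>j\<close>.\<close>

lemma lookup_jet:
  "lookup (jet m N j f) \<mu> = (if keys \<mu> \<subseteq> {1..m} \<times> {1..N}
    then of_nat (universal_factor j \<mu>) * f (row_exponent \<mu>) else 0)"
proof -
  let ?g = "\<lambda>\<mu>. if keys \<mu> \<subseteq> {1..m} \<times> {1..N}
    then of_nat (universal_factor j \<mu>) * f (row_exponent \<mu>) else 0"
  have "{\<mu>. ?g \<mu> \<noteq> 0} \<subseteq> {\<mu>. keys \<mu> \<subseteq> {1..m} \<times> {1..N} \<and> (\<forall>v. lookup \<mu> v \<le> j)}"
  proof
    fix \<mu> assume "\<mu> \<in> {\<mu>. ?g \<mu> \<noteq> 0}"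
    then have *: "keys \<mu> \<subseteq> {1..m} \<times> {1..N}" "weight \<mu> = j"
      by (auto simp: universal_factor_def split: if_splits)
    have "lookup \<mu> v \<le> j" for v
      using lookup_le_mdeg[of \<mu> v] mdeg_le_weight[OF *(1)] *(2) by simp
    then show "\<mu> \<in> {\<mu>. keys \<mu> \<subseteq> {1..m} \<times> {1..N} \<and> (\<forall>v. lookup \<mu> v \<le> j)}"
      using *(1) by blast
  qed
  then have "finite {\<mu>. ?g \<mu> \<noteq> 0}"
    by (rule finite_subset) (intro finite_bounded_monomials finite_SigmaI finite_atLeastAtMost)
  then show ?thesis by (simp add: jet_def)
qed

lemma jet_closed: "jet m N j f \<in> carrier (poly_ring ({1..m} \<times> {1..N}))"
  unfolding poly_ring_carrier_iff
proof
  fix \<mu> assume "\<mu> \<in> keys (jet m N j f)"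
  then have "lookup (jet m N j f) \<mu> \<noteq> 0" by (simp add: in_keys_iff)
  then show "keys \<mu> \<subseteq> {1..m} \<times> {1..N}" unfolding lookup_jet by presburger
qed

lemma total_degree_jet: "total_degree (jet m N j f) \<le> j"
proof -
  have "mdeg \<mu> \<le> j" if "\<mu> \<in> keys (jet m N j f)" for \<mu>
    using that mdeg_le_weight[of \<mu> m N]
    by (auto simp: in_keys_iff lookup_jet universal_factor_def split: if_splits)
  then show ?thesis by (auto simp: total_degree_def)
qed

lemma row_exponent_keys:
  "keys \<mu> \<subseteq> {1..m} \<times> {1..N} \<Longrightarrow> keys (row_exponent \<mu>) \<subseteq> {1..m}"
  using keys_row_exponent[of \<mu>] by fastforce

text \<open>Each \<open>Y_l\<close> is divisible by \<open>t\<close>, so monomials of degree above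
  \<open>j\<close> do not contribute to \<open>t^j\<close>. Hence a jet with
  \<open>j \<le> N\<close> depends only on the truncated series.\<close>

lemma jet_cong:
  assumes "\<And>a. \<lbrakk>mdeg a \<le> j; keys a \<subseteq> {1..m}\<rbrakk> \<Longrightarrow> f a = g a"
  shows "jet m N j f = jet m N j g"
proof (rule poly_mapping_eqI)
  fix \<mu>
  show "lookup (jet m N j f) \<mu> = lookup (jet m N j g) \<mu>"
    using assms[of "row_exponent \<mu>"] mdeg_le_weight[of \<mu> m N] row_exponent_keys[of \<mu> m N]
    by (auto simp: lookup_jet universal_factor_def)
qed

lemma jet_add: "jet m N j (\<lambda>a. f a + g a) = jet m N j f + jet m N j g"
  by (rule poly_mapping_eqI) (simp add: lookup_jet lookup_add algebra_simps)

lemma jet_const: "jet m N j (ps_const c) = (if j = 0 then poly_const c else 0)"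
  by (rule poly_mapping_eqI)
    (auto simp: lookup_jet ps_const_def poly_const_def universal_factor_def lookup_single when_def)

text \<open>At \<open>t = 0\<close> all \<open>Y_l\<close> vanish and only the constant term
  survives.\<close>

lemma jet_0: "jet m N 0 f = poly_const (f 0)"
proof (rule poly_mapping_eqI)
  fix \<mu>
  have "\<mu> = 0" if "keys \<mu> \<subseteq> {1..m} \<times> {1..N}" "weight \<mu> = 0"
    using mdeg_le_weight[OF that(1)] that(2) by simp
  then show "lookup (jet m N 0 f) \<mu> = lookup (poly_const (f 0)) \<mu>"
    by (auto simp: lookup_jet poly_const_def universal_factor_def lookup_single when_def)
qed

lemma mdeg_eq_1E:
  assumes "mdeg a = 1"
  obtains v where "a = single v 1"
proof -
  have "keys a \<noteq> {}" using assms by auto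
  then obtain v where "v \<in> keys a" by blast
  then have a: "a - single v 1 + single v 1 = a" by (rule monomial_split_key)
  have "mdeg (a - single v 1) = 0" using arg_cong[OF a, of mdeg] assms by simp
  then show ?thesis using that[of v] a by simp
qed

text \<open>Each row has at most one entry, so numerator and denominator consist of the same
  factorials.\<close>

lemma multinomial_factor_first_column:
  assumes "snd ` keys \<mu> \<subseteq> {1}"
  shows "multinomial_factor \<mu> = 1"
proof -
  have first: "s = 1" if "(l, s) \<in> keys \<mu>" for l s
    using assms that by force
  have row: "lookup (row_exponent \<mu>) l = lookup \<mu> (l, 1)" for l
  proof -
    have "lookup (row_exponent \<mu>) l = (\<Sum>s\<in>{1}. lookup \<mu> (l, s))"
      unfolding lookup_row_exponent by (intro sum.mono_neutral_left) (auto dest: first, simp add: in_keys_iff)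
    then show ?thesis by simp
  qed
  have "mono_fact (row_exponent \<mu>) = (\<Prod>l\<in>fst ` keys \<mu>. fact (lookup (row_exponent \<mu>) l))"
    by (intro mono_fact_superset keys_row_exponent) simp
  also have "\<dots> = (\<Prod>v\<in>keys \<mu>. fact (lookup \<mu> (fst v, 1)))"
    unfolding row by (rule prod.reindex[unfolded o_def]) (auto simp: inj_on_def dest: first)
  also have "\<dots> = mono_fact \<mu>"
    unfolding mono_fact_def
  proof (rule prod.cong[OF refl])
    fix v assume "v \<in> keys \<mu>"
    then have "(fst v, 1) = v" using first[of "fst v" "snd v"] by (cases v) simp
    then show "fact (lookup \<mu> (fst v, 1)) = fact (lookup \<mu> v)" by simp
  qed
  finally show ?thesis
    using mono_fact_pos[of \<mu>] by (simp add: multinomial_factor_altdef)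
qed

text \<open>Substitution turns the variable \<open>i\<close> into \<open>Y_i\<close>, which has
  coefficients only at \<open>t^1\<close> to \<open>t^N\<close>. In terms of monomials, row exponent
  \<open>single i 1\<close> forces \<open>\<mu>\<close> to be a single variable of row
  \<open>i\<close>.\<close>

lemma jet_var:
  fixes i j :: nat
  assumes "i \<in> {1..m}"
  shows "jet m N j (ps_var i) = (if j \<in> {1..N} then poly_var (i, j) else (0 :: (nat \<times> nat, 'k::comm_ring_1) polynomial))"
proof (rule poly_mapping_eqI)
  fix \<mu>
  show "lookup (jet m N j (ps_var i)) \<mu>
    = lookup (if j \<in> {1..N} then poly_var (i, j) else (0 :: (nat \<times> nat, 'k) polynomial)) \<mu>"
  proof (cases "row_exponent \<mu> = single i 1")
    case True
    have "mdeg \<mu> = 1" unfolding mdeg_row_exponent[symmetric] True by simp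
    then obtain v where "\<mu> = single v 1" by (rule mdeg_eq_1E)
    then obtain l s where \<mu>: "\<mu> = single (l, s) 1" by (cases v) auto
    have l: "l = i" using arg_cong[OF True, of keys] by (simp add: \<mu>)
    have eq: "single (i, j) (1::nat) = single (i, s) 1 \<longleftrightarrow> s = j"
    proof
      assume "single (i, j) (1::nat) = single (i, s) 1"
      from arg_cong[OF this, of keys] show "s = j" by simp
    qed simp
    have mf: "multinomial_factor (single (i, t) (Suc 0)) = 1" for t
      by (simp add: multinomial_factor_altdef mono_fact_def)
    have jet: "lookup (jet m N j (ps_var i)) \<mu> = (if s \<in> {1..N} \<and> s = j then 1 else (0 :: 'k))"
      unfolding lookup_jet \<mu> l universal_factor_def ps_var_def using assms
      by (auto simp: mf)
    have var: "lookup (poly_var (i, j)) \<mu> = (if s = j then 1 else (0 :: 'k))"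
      unfolding poly_var_def lookup_single when_def \<mu> l eq ..
    show ?thesis unfolding if_distrib[of "\<lambda>p. lookup p \<mu>"] jet var by auto
  next
    case False
    then have "single (i, j) 1 \<noteq> \<mu>" by auto
    then have var: "lookup (poly_var (i, j)) \<mu> = (0 :: 'k)"
      unfolding poly_var_def lookup_single when_def by simp
    have jet: "lookup (jet m N j (ps_var i)) \<mu> = (0 :: 'k)"
      unfolding lookup_jet ps_var_def if_not_P[OF False] by simp
    show ?thesis unfolding if_distrib[of "\<lambda>p. lookup p \<mu>"] jet var by simp
  qed
qed

text \<open>Substitution is multiplicative, and the sum is the Cauchy product in \<open>t\<close>.
  At a monomial \<open>\<mu>\<close>, the pairs with \<open>b + c = \<mu>\<close> are grouped by
  their two row exponents. The coefficients of \<open>f\<close> and \<open>g\<close> are constant on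
  each group, and \<open>multinomial_factor_vandermonde\<close> sums the remaining factors.\<close>

lemma jet_mult:
  "jet m N j (ps_mult f g) = (\<Sum>i\<le>j. jet m N i f * jet m N (j - i) g)"
proof (rule poly_mapping_eqI)
  fix \<mu>
  let ?mf = "\<lambda>b. of_nat (multinomial_factor b) :: 'a"
  let ?V = "{1..m} \<times> {1..N}"
  have swap: "lookup (\<Sum>i\<le>j. jet m N i f * jet m N (j - i) g) \<mu>
    = (\<Sum>(b, c)\<in>splits \<mu>. \<Sum>i\<le>j. lookup (jet m N i f) b * lookup (jet m N (j - i) g) c)"
    unfolding lookup_sum lookup_mult_splits case_prod_unfold by (rule sum.swap)
  show "lookup (jet m N j (ps_mult f g)) \<mu>
    = lookup (\<Sum>i\<le>j. jet m N i f * jet m N (j - i) g) \<mu>"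
  proof (cases "keys \<mu> \<subseteq> ?V")
    case False
    \<comment> \<open>A variable of \<open>\<mu>\<close> outside \<open>?V\<close> occurs in
      \<open>b\<close> or in \<open>c\<close>, so every summand vanishes.\<close>
    have "(\<Sum>i\<le>j. lookup (jet m N i f) b * lookup (jet m N (j - i) g) c) = 0"
      if "(b, c) \<in> splits \<mu>" for b c
    proof -
      have "\<not> keys b \<subseteq> ?V \<or> \<not> keys c \<subseteq> ?V"
        using False that keys_add_monomial[of b c] by auto
      then show ?thesis by (intro sum.neutral) (auto simp: lookup_jet)
    qed
    then have "(\<Sum>(b, c)\<in>splits \<mu>. \<Sum>i\<le>j. lookup (jet m N i f) b * lookup (jet m N (j - i) g) c) = 0"
      by (intro sum.neutral) auto
    then show ?thesis unfolding swap using False by (simp only: lookup_jet if_False)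
  next
    case True
    \<comment> \<open>Only \<open>i = weight b\<close> contributes, and then
      \<open>weight c = j - i\<close> says that \<open>weight \<mu> = j\<close>.\<close>
    have inner: "(\<Sum>i\<le>j. lookup (jet m N i f) b * lookup (jet m N (j - i) g) c)
      = (if weight \<mu> = j then ?mf b * ?mf c * (f (row_exponent b) * g (row_exponent c)) else 0)"
      if bc: "(b, c) \<in> splits \<mu>" for b c
    proof -
      have keys: "keys b \<subseteq> ?V" "keys c \<subseteq> ?V"
        using True bc keys_add_monomial[of b c] by auto
      have w: "weight \<mu> = weight b + weight c" using bc by auto
      have "(\<Sum>i\<le>j. lookup (jet m N i f) b * lookup (jet m N (j - i) g) c)
        = (\<Sum>i\<le>j. if i = weight b then (if weight c = j - i
            then ?mf b * ?mf c * (f (row_exponent b) * g (row_exponent c)) else 0) else 0)"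
        using keys by (intro sum.cong refl) (simp add: lookup_jet universal_factor_def)
      also have "\<dots> = (if weight \<mu> = j then ?mf b * ?mf c * (f (row_exponent b) * g (row_exponent c)) else 0)"
        by (auto simp: w)
      finally show ?thesis .
    qed
    let ?r = "\<lambda>(b, c). (row_exponent b, row_exponent c)"
    let ?h = "\<lambda>(b, c). ?mf b * ?mf c * (f (row_exponent b) * g (row_exponent c))"
    have fibre: "sum ?h {x \<in> splits \<mu>. ?r x = y} = ?mf \<mu> * (f (fst y) * g (snd y))"
      if "y \<in> splits (row_exponent \<mu>)" for y
    proof -
      obtain p q where y: "y = (p, q)" by (cases y)
      then have pq: "p + q = row_exponent \<mu>" using that by simp
      have row: "row_exponent c = q" if "b + c = \<mu>" "row_exponent b = p" for b c
        using pq unfolding that(1)[symmetric] row_exponent_add that(2) by simp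
      have "{x \<in> splits \<mu>. ?r x = y} = {(b, c) \<in> splits \<mu>. row_exponent b = p}"
        by (auto simp: y intro: row)
      then have "sum ?h {x \<in> splits \<mu>. ?r x = y}
        = (\<Sum>(b, c)\<in>{(b, c) \<in> splits \<mu>. row_exponent b = p}. ?mf b * ?mf c * (f p * g q))"
        using y by (intro sum.cong) auto
      also have "\<dots> = of_nat (\<Sum>(b, c)\<in>{(b, c) \<in> splits \<mu>. row_exponent b = p}.
          multinomial_factor b * multinomial_factor c) * (f p * g q)"
        by (simp add: sum_distrib_right case_prod_unfold)
      also have "\<dots> = ?mf \<mu> * (f p * g q)"
        by (simp only: multinomial_factor_vandermonde[OF pq])
      finally show ?thesis by (simp add: y)
    qed
    have "sum ?h (splits \<mu>) = (\<Sum>y\<in>splits (row_exponent \<mu>). sum ?h {x \<in> splits \<mu>. ?r x = y})"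
      by (rule sum.group[symmetric]) auto
    also have "\<dots> = (\<Sum>y\<in>splits (row_exponent \<mu>). ?mf \<mu> * (f (fst y) * g (snd y)))"
      by (rule sum.cong[OF refl fibre])
    also have "\<dots> = ?mf \<mu> * ps_mult f g (row_exponent \<mu>)"
      by (simp add: ps_mult_def sum_distrib_left case_prod_unfold)
    finally have total: "sum ?h (splits \<mu>) = ?mf \<mu> * ps_mult f g (row_exponent \<mu>)" .
    have "lookup (\<Sum>i\<le>j. jet m N i f * jet m N (j - i) g) \<mu>
      = (\<Sum>x\<in>splits \<mu>. if weight \<mu> = j then ?h x else 0)"
      unfolding swap
    proof (rule sum.cong[OF refl])
      fix x assume x: "x \<in> splits \<mu>"
      obtain b c where "x = (b, c)" by (cases x)
      then show "(case x of (b, c) \<Rightarrow> \<Sum>i\<le>j. lookup (jet m N i f) b * lookup (jet m N (j - i) g) c)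
          = (if weight \<mu> = j then ?h x else 0)"
        using inner[of b c] x by (simp only: prod.case)
    qed
    also have "\<dots> = (if weight \<mu> = j then ?mf \<mu> * ps_mult f g (row_exponent \<mu>) else 0)"
      using total by (cases "weight \<mu> = j") (simp_all only: if_True if_False sum.neutral_const simp_thms)
    also have "\<dots> = lookup (jet m N j (ps_mult f g)) \<mu>"
      unfolding lookup_jet if_P[OF True] universal_factor_def by simp
    finally show ?thesis by (rule sym)
  qed
qed

section \<open>Groups of automorphisms\<close>

lemma alg_aut_Bij: "f \<in> alg_aut A \<iota> \<Longrightarrow> f \<in> Bij (carrier A)"
  by (auto simp: alg_aut_def Bij_def ring_iso_def)

lemma alg_autI:
  assumes "f \<in> Bij (carrier A)" "f \<in> ring_hom A A" "\<And>c. f (\<iota> c) = \<iota> c"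
  shows "f \<in> alg_aut A \<iota>"
  using assms by (auto simp: alg_aut_def Bij_def ring_iso_def)

text \<open>Treats both groups at once: \<open>J = {}\<close> imposes no condition and yields
  \<open>GA\<close>, while \<open>J = var_ideal m N\<close> yields \<open>trunc_Aut\<close>.\<close>

lemma subgroup_alg_aut_stabilizer:
  assumes "ring A" and \<iota>: "\<And>c. \<iota> c \<in> carrier A" and J: "J \<subseteq> carrier A"
  shows "subgroup {f \<in> alg_aut A \<iota>. f ` J = J} (BijGroup (carrier A))"
proof (rule subgroup.intro)
  interpret ring A by fact
  let ?H = "{f \<in> alg_aut A \<iota>. f ` J = J}"
  show "?H \<subseteq> carrier (BijGroup (carrier A))"
    by (auto simp: BijGroup_def alg_aut_Bij)
  show "\<one>\<^bsub>BijGroup (carrier A)\<^esub> \<in> ?H"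
    using J \<iota> by (auto simp: BijGroup_def id_Bij intro!: alg_autI ring_hom_memI)
  fix f assume f: "f \<in> ?H"
  then have fB: "f \<in> Bij (carrier A)" and fh: "f \<in> ring_hom A A"
    and fc: "f (\<iota> c) = \<iota> c" and fJ: "f ` J = J" for c
    using alg_aut_Bij by (auto simp: alg_aut_def ring_iso_def)
  note f_closed = ring_hom_closed[OF fh]
  show "f \<otimes>\<^bsub>BijGroup (carrier A)\<^esub> g \<in> ?H" if "g \<in> ?H" for g
  proof -
    have gB: "g \<in> Bij (carrier A)" and gh: "g \<in> ring_hom A A"
      and gc: "g (\<iota> c) = \<iota> c" and gJ: "g ` J = J" for c
      using that alg_aut_Bij by (auto simp: alg_aut_def ring_iso_def)
    have "compose (carrier A) f g \<in> ring_hom A A"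
      using ring_hom_closed[OF gh] f_closed
      by (intro ring_hom_memI) (simp_all add: compose_eq ring_hom_mult[OF gh] ring_hom_mult[OF fh]
          ring_hom_add[OF gh] ring_hom_add[OF fh] ring_hom_one[OF gh] ring_hom_one[OF fh])
    moreover have "compose (carrier A) f g ` J = f ` (g ` J)"
      unfolding image_image using J by (intro image_cong refl) (auto simp: compose_eq)
    ultimately show ?thesis
      using fB gB \<iota> fc gc fJ gJ
      by (auto simp: BijGroup_def compose_eq intro!: alg_autI compose_Bij)
  qed
  \<comment> \<open>This is the inverse of \<open>f\<close> in \<open>BijGroup\<close>, made
    extensional by the restriction.\<close>
  let ?g = "\<lambda>x\<in>carrier A. inv_into (carrier A) f x"
  have inj: "inj_on f (carrier A)" using fB by (auto simp: Bij_def bij_betw_def)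
  have "?g \<in> ring_hom A A"
  proof (rule ring_hom_memI)
    show "?g x \<in> carrier A" if "x \<in> carrier A" for x
      using that Bij_inv_into_mem[OF fB] by simp
    show "?g (x \<otimes>\<^bsub>A\<^esub> y) = ?g x \<otimes>\<^bsub>A\<^esub> ?g y" if "x \<in> carrier A" "y \<in> carrier A" for x y
      using Bij_inv_into_lemma[of "carrier A" f "mult A" x y] ring_hom_mult[OF fh] fB that by auto
    show "?g (x \<oplus>\<^bsub>A\<^esub> y) = ?g x \<oplus>\<^bsub>A\<^esub> ?g y" if "x \<in> carrier A" "y \<in> carrier A" for x y
      using Bij_inv_into_lemma[of "carrier A" f "add A" x y] ring_hom_add[OF fh] fB that by auto
    show "?g \<one>\<^bsub>A\<^esub> = \<one>\<^bsub>A\<^esub>"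
      using inv_into_f_f[OF inj, of "\<one>\<^bsub>A\<^esub>"] ring_hom_one[OF fh] by simp
  qed
  moreover have "?g (\<iota> c) = \<iota> c" for c
    using inv_into_f_f[OF inj \<iota>, of c] fc \<iota> by simp
  moreover have "?g ` J = J"
  proof -
    have "?g ` (f ` J) = J"
      unfolding image_image using J inj f_closed by (force simp: subset_iff)
    then show ?thesis by (simp only: fJ)
  qed
  ultimately show "inv\<^bsub>BijGroup (carrier A)\<^esub> f \<in> ?H"
    using restrict_inv_into_Bij[OF fB] by (simp add: inv_BijGroup[OF fB] alg_autI)
qed

lemma GA_group: "group (GA V :: (('x, 'k::comm_ring_1) polynomial \<Rightarrow> ('x, 'k) polynomial) monoid)"
  using subgroup.subgroup_is_group[OF subgroup_alg_aut_stabilizer group_BijGroup,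
      of "poly_ring V :: ('x, 'k) polynomial ring" poly_const "{}"]
  by (simp add: GA_def poly_ring_ring poly_const_closed)

section \<open>The automorphism group of the truncated ring\<close>

lemma trunc_class_closed:
  "f \<in> carrier (power_series_ring m) \<Longrightarrow> trunc_class m N f \<in> carrier (trunc_ring m N)"
  by (simp add: trunc_ring_carrier)

text \<open>The classes of series without constant term form an ideal of the quotient. It contains
  the variables, hence all of \<open>var_ideal m N\<close>.\<close>

lemma trunc_coeff_vars_ideal:
  fixes C :: "'k::comm_ring_1 power_series set"
  assumes "C \<in> var_ideal m N"
  shows "C \<in> carrier (trunc_ring m N)" and "trunc_coeff C 0 = 0"
proof -
  interpret T: ring "trunc_ring m N :: 'k power_series set ring" by (rule trunc_ring_ring)
  interpret R: cring "power_series_ring m :: 'k power_series ring" by (rule power_series_cring)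
  have "ideal (trunc_class m N ` ord_ideal m 1) (trunc_ring m N :: 'k power_series set ring)"
    using R.ring_ideal_imp_quot_ideal[OF ord_ideal_ideal[of m "Suc N"] ord_ideal_ideal[of m 1]]
    by (simp add: trunc_ring_def trunc_class_def trunc_ideal_eq)
  then have "var_ideal m N \<subseteq> trunc_class m N ` (ord_ideal m 1 :: 'k power_series set)"
    unfolding var_ideal_def using ps_var_ord_ideal by (intro T.genideal_minimal) blast+
  then obtain f where "f \<in> ord_ideal m 1" "C = trunc_class m N f" using assms by blast
  then show "C \<in> carrier (trunc_ring m N)" "trunc_coeff C 0 = 0"
    by (auto simp: ord_ideal_def trunc_class_closed trunc_coeff_class)
qed

lemma var_ideal_vars:
  assumes "i \<in> {1..m}"
  shows "trunc_class m N (ps_var i :: 'k::comm_ring_1 power_series) \<in> var_ideal m N"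
proof -
  interpret T: ring "trunc_ring m N :: 'k power_series set ring" by (rule trunc_ring_ring)
  have "(\<lambda>i. trunc_class m N (ps_var i)) ` {1..m} \<subseteq> carrier (trunc_ring m N :: 'k power_series set ring)"
    using ps_var_closed trunc_class_closed by blast
  then show ?thesis
    unfolding var_ideal_def using T.genideal_self assms by blast
qed

lemma trunc_Aut_group:
  "group (trunc_Aut m N :: ('k::comm_ring_1 power_series set \<Rightarrow> 'k power_series set) monoid)"
  unfolding trunc_Aut_def
  by (intro subgroup.subgroup_is_group subgroup_alg_aut_stabilizer group_BijGroup trunc_ring_ring
      trunc_class_closed ps_const_closed subsetI trunc_coeff_vars_ideal(1))

lemma trunc_AutD:
  fixes \<phi> :: "'k::comm_ring_1 power_series set \<Rightarrow> 'k power_series set"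
  assumes "\<phi> \<in> carrier (trunc_Aut m N)"
  shows "\<phi> \<in> Bij (carrier (trunc_ring m N))"
    and "\<phi> \<in> ring_hom (trunc_ring m N) (trunc_ring m N)"
    and "\<phi> (trunc_class m N (ps_const c)) = trunc_class m N (ps_const c)"
    and "i \<in> {1..m} \<Longrightarrow> component m N \<phi> i \<in> carrier (trunc_ring m N)"
    and "i \<in> {1..m} \<Longrightarrow> trunc_coeff (component m N \<phi> i) 0 = 0"
proof -
  have \<phi>: "\<phi> \<in> alg_aut (trunc_ring m N) (\<lambda>c. trunc_class m N (ps_const c))"
    "\<phi> ` var_ideal m N = var_ideal m N"
    using assms by (auto simp: trunc_Aut_def)
  then show "\<phi> \<in> Bij (carrier (trunc_ring m N))" by (intro alg_aut_Bij)
  show "\<phi> \<in> ring_hom (trunc_ring m N) (trunc_ring m N)"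
    "\<phi> (trunc_class m N (ps_const c)) = trunc_class m N (ps_const c)"
    using \<phi>(1) by (auto simp: alg_aut_def ring_iso_def)
  \<comment> \<open>Invariance of \<open>var_ideal m N\<close> puts the component into that ideal,
    which is why it has no constant term.\<close>
  assume "i \<in> {1..m}"
  then have "component m N \<phi> i \<in> var_ideal m N"
    using \<phi>(2) var_ideal_vars unfolding component_def by blast
  then show "component m N \<phi> i \<in> carrier (trunc_ring m N)" "trunc_coeff (component m N \<phi> i) 0 = 0"
    by (rule trunc_coeff_vars_ideal)+
qed

lemma trunc_Aut_mult:
  assumes "\<phi> \<in> carrier (trunc_Aut m N)" "\<psi> \<in> carrier (trunc_Aut m N)"
  shows "\<phi> \<otimes>\<^bsub>trunc_Aut m N\<^esub> \<psi> = compose (carrier (trunc_ring m N)) \<phi> \<psi>"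
  using trunc_AutD(1)[OF assms(1)] trunc_AutD(1)[OF assms(2)]
  by (simp add: trunc_Aut_def BijGroup_def)

lemma trunc_eqI:
  fixes C D :: "'k::comm_ring_1 power_series set"
  assumes "C \<in> carrier (trunc_ring m N)" "D \<in> carrier (trunc_ring m N)"
    and eq: "\<And>a. \<lbrakk>mdeg a \<le> N; keys a \<subseteq> {1..m}\<rbrakk> \<Longrightarrow> trunc_coeff C a = trunc_coeff D a"
  shows "C = D"
proof -
  obtain f g where f: "f \<in> carrier (power_series_ring m)" "C = trunc_class m N f"
    and g: "g \<in> carrier (power_series_ring m)" "D = trunc_class m N g"
    using assms(1,2) by (auto simp: trunc_ring_carrier)
  have "f a = g a" if "mdeg a \<le> N" for a
  proof (cases "keys a \<subseteq> {1..m}")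
    case True
    then show ?thesis using eq[OF that] f g that by (simp add: trunc_coeff_class)
  next
    case False
    then have "f a = 0" "g a = 0" using f g unfolding power_series_carrier_iff by blast+
    then show ?thesis by simp
  qed
  then show ?thesis using f g by (simp add: trunc_class_eq_iff)
qed

text \<open>Both maps fix the constants and agree on the variables, which together generate the
  ring. Outside the carrier both are \<open>undefined\<close>.\<close>

lemma trunc_hom_eqI:
  fixes \<phi> \<psi> :: "'k::comm_ring_1 power_series set \<Rightarrow> 'k power_series set"
  assumes \<phi>: "\<phi> \<in> carrier (trunc_Aut m N)" and \<psi>: "\<psi> \<in> carrier (trunc_Aut m N)"
    and eq: "\<And>i. i \<in> {1..m} \<Longrightarrow> component m N \<phi> i = component m N \<psi> i"
  shows "\<phi> = \<psi>"
proof (rule extensionalityI)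
  show "\<phi> \<in> extensional (carrier (trunc_ring m N))" "\<psi> \<in> extensional (carrier (trunc_ring m N))"
    using trunc_AutD(1)[OF \<phi>] trunc_AutD(1)[OF \<psi>] Bij_imp_extensional by blast+
  fix C :: "'k power_series set" assume "C \<in> carrier (trunc_ring m N)"
  then show "\<phi> C = \<psi> C"
    by (induction rule: trunc_ring_induct)
      (simp_all add: trunc_AutD(3)[OF \<phi>] trunc_AutD(3)[OF \<psi>] eq[unfolded component_def]
        ring_hom_add[OF trunc_AutD(2)[OF \<phi>]] ring_hom_add[OF trunc_AutD(2)[OF \<psi>]]
        ring_hom_mult[OF trunc_AutD(2)[OF \<phi>]] ring_hom_mult[OF trunc_AutD(2)[OF \<psi>]])
qed

section \<open>The homomorphism\<close>

text \<open>A jet at \<open>j \<le> N\<close> uses only coefficients of degree at most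
  \<open>N\<close>, where \<open>trunc_coeff\<close> is specified and agrees with every
  representative.\<close>

lemma jet_trunc_class:
  assumes "f \<in> carrier (power_series_ring m)" "j \<le> N"
  shows "jet m N j (trunc_coeff (trunc_class m N f)) = jet m N j f"
  using assms by (intro jet_cong trunc_coeff_class) auto

lemma jet_trunc_add:
  fixes C D :: "'k::comm_ring_1 power_series set"
  assumes "C \<in> carrier (trunc_ring m N)" "D \<in> carrier (trunc_ring m N)" "j \<le> N"
  shows "jet m N j (trunc_coeff (C \<oplus>\<^bsub>trunc_ring m N\<^esub> D))
    = jet m N j (trunc_coeff C) + jet m N j (trunc_coeff D)"
proof -
  obtain f g where f: "f \<in> carrier (power_series_ring m)" "C = trunc_class m N f"
    and g: "g \<in> carrier (power_series_ring m)" "D = trunc_class m N g"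
    using assms(1,2) by (auto simp: trunc_ring_carrier)
  have "C \<oplus>\<^bsub>trunc_ring m N\<^esub> D = trunc_class m N (\<lambda>a. f a + g a)"
    using ring_hom_add[OF trunc_class_hom f(1) g(1), of N] f g by simp
  then show ?thesis
    using f g assms(3) by (simp add: jet_trunc_class ps_add_closed jet_add)
qed

lemma jet_trunc_mult:
  fixes C D :: "'k::comm_ring_1 power_series set"
  assumes "C \<in> carrier (trunc_ring m N)" "D \<in> carrier (trunc_ring m N)" "j \<le> N"
  shows "jet m N j (trunc_coeff (C \<otimes>\<^bsub>trunc_ring m N\<^esub> D))
    = (\<Sum>i\<le>j. jet m N i (trunc_coeff C) * jet m N (j - i) (trunc_coeff D))"
proof -
  obtain f g where f: "f \<in> carrier (power_series_ring m)" "C = trunc_class m N f"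
    and g: "g \<in> carrier (power_series_ring m)" "D = trunc_class m N g"
    using assms(1,2) by (auto simp: trunc_ring_carrier)
  have "C \<otimes>\<^bsub>trunc_ring m N\<^esub> D = trunc_class m N (ps_mult f g)"
    using ring_hom_mult[OF trunc_class_hom f(1) g(1), of N] f g by simp
  then show ?thesis
    using f g assms(3) by (simp add: jet_trunc_class ps_mult_closed jet_mult)
qed

definition jet_vars :: "nat \<Rightarrow> nat \<Rightarrow> (nat \<times> nat) set" where
  "jet_vars m N = {1..m} \<times> {1..N}"

definition jet_images ::
    "nat \<Rightarrow> nat \<Rightarrow> ('k::comm_ring_1 power_series set \<Rightarrow> 'k power_series set) \<Rightarrow> nat \<times> nat
      \<Rightarrow> (nat \<times> nat, 'k) polynomial" where
  "jet_images m N \<phi> = (\<lambda>(i, j). jet m N j (trunc_coeff (component m N \<phi> i)))"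

text \<open>Restricted to the carrier because members of \<open>GA\<close> are extensional
  there.\<close>

definition jet_aut ::
    "nat \<Rightarrow> nat \<Rightarrow> ('k::comm_ring_1 power_series set \<Rightarrow> 'k power_series set)
      \<Rightarrow> (nat \<times> nat, 'k) polynomial \<Rightarrow> (nat \<times> nat, 'k) polynomial" where
  "jet_aut m N \<phi> = (\<lambda>p\<in>carrier (poly_ring (jet_vars m N)). poly_subst (jet_images m N \<phi>) p)"

text \<open>Both sides are homomorphisms in \<open>C\<close>, and they agree on the generators because
  \<open>\<phi>\<^sub>i\<close> has no constant term.\<close>

lemma poly_subst_jet:
  fixes \<phi> :: "'k::comm_ring_1 power_series set \<Rightarrow> 'k power_series set"
  assumes \<phi>: "\<phi> \<in> carrier (trunc_Aut m N)" and C: "C \<in> carrier (trunc_ring m N)" and j: "j \<le> N"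
  shows "poly_subst (jet_images m N \<phi>) (jet m N j (trunc_coeff C)) = jet m N j (trunc_coeff (\<phi> C))"
  using C j
\<comment> \<open>\<open>j\<close> stays arbitrary because the jet of a product at \<open>j\<close>
  involves the jets of its factors at all \<open>i \<le> j\<close>.\<close>
proof (induction arbitrary: j rule: trunc_ring_induct)
  case (const c)
  then show ?case
    by (simp add: trunc_AutD(3)[OF \<phi>] jet_trunc_class ps_const_closed jet_const)
next
  case (var i)
  show ?case
  proof (cases "j = 0")
    \<comment> \<open>The left side is 0 since \<open>Y_i\<close> has no term at \<open>t^0\<close>.
      The right side is the constant term of the component, which vanishes as well.\<close>
    case True
    then show ?thesis
      using trunc_AutD(5)[OF \<phi> var(1)] var
      by (simp add: jet_trunc_class ps_var_closed jet_var jet_0[of m N "trunc_coeff (\<phi> _)"] component_def)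
  next
    case False
    then show ?thesis
      using var by (simp add: jet_trunc_class ps_var_closed jet_var jet_images_def component_def)
  qed
next
  case (add C D)
  note closed = ring_hom_closed[OF trunc_AutD(2)[OF \<phi>]]
  show ?case
    using add by (simp add: ring_hom_add[OF trunc_AutD(2)[OF \<phi>]] jet_trunc_add closed poly_subst_add)
next
  case (mult C D)
  note closed = ring_hom_closed[OF trunc_AutD(2)[OF \<phi>]]
  show ?case
    using mult by (simp add: ring_hom_mult[OF trunc_AutD(2)[OF \<phi>]] jet_trunc_mult closed
        poly_subst_sum poly_subst_mult)
qed

lemma jet_images_closed:
  "jet_images m N \<phi> v \<in> carrier (poly_ring (jet_vars m N))"
  unfolding jet_images_def jet_vars_def by (cases v) (simp only: prod.case jet_closed)

lemma jet_aut_closed: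
  "p \<in> carrier (poly_ring (jet_vars m N)) \<Longrightarrow> jet_aut m N \<phi> p \<in> carrier (poly_ring (jet_vars m N))"
  unfolding jet_aut_def by (simp add: poly_subst_closed jet_images_closed)

lemma jet_aut_var:
  "\<lbrakk>i \<in> {1..m}; j \<in> {1..N}\<rbrakk> \<Longrightarrow>
    jet_aut m N \<phi> (poly_var (i, j)) = jet m N j (trunc_coeff (component m N \<phi> i))"
  unfolding jet_aut_def by (simp add: poly_var_closed jet_images_def jet_vars_def)

text \<open>The inner substitution sends the variable \<open>(i, j)\<close> to a jet of
  \<open>\<psi>_i\<close>, and \<open>poly_subst_jet\<close> turns this into the same jet of
  \<open>\<phi> (\<psi>_i)\<close>. The order of composition is therefore preserved.\<close>

lemma jet_aut_mult:
  assumes \<phi>: "\<phi> \<in> carrier (trunc_Aut m N)" and \<psi>: "\<psi> \<in> carrier (trunc_Aut m N)"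
  shows "jet_aut m N (\<phi> \<otimes>\<^bsub>trunc_Aut m N\<^esub> \<psi>)
    = compose (carrier (poly_ring (jet_vars m N))) (jet_aut m N \<phi>) (jet_aut m N \<psi>)"
proof -
  let ?V = "jet_vars m N"
  have "poly_subst (jet_images m N (\<phi> \<otimes>\<^bsub>trunc_Aut m N\<^esub> \<psi>)) p
    = poly_subst (jet_images m N \<phi>) (poly_subst (jet_images m N \<psi>) p)"
    if "p \<in> carrier (poly_ring ?V)" for p
    using that
  proof (induction rule: poly_ring_induct)
    case (var v)
    then obtain i j where v: "v = (i, j)" "i \<in> {1..m}" "j \<in> {1..N}" by (auto simp: jet_vars_def)
    have "component m N (\<phi> \<otimes>\<^bsub>trunc_Aut m N\<^esub> \<psi>) i = \<phi> (component m N \<psi> i)"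
      using v by (simp add: component_def trunc_Aut_mult[OF \<phi> \<psi>] compose_eq trunc_class_closed ps_var_closed)
    moreover have "poly_subst (jet_images m N \<phi>) (jet m N j (trunc_coeff (component m N \<psi> i)))
        = jet m N j (trunc_coeff (\<phi> (component m N \<psi> i)))"
      using v by (intro poly_subst_jet[OF \<phi> trunc_AutD(4)[OF \<psi>]]) auto
    ultimately show ?case by (simp add: v(1) jet_images_def)
  qed (simp_all add: poly_subst_add poly_subst_mult)
  then show ?thesis
    by (auto simp: compose_def jet_aut_def poly_subst_closed jet_images_closed fun_eq_iff)
qed

lemma jet_aut_one:
  "jet_aut m N \<one>\<^bsub>trunc_Aut m N\<^esub> = (\<lambda>p\<in>carrier (poly_ring (jet_vars m N)). p)"
proof -
  let ?V = "jet_vars m N"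
  have "poly_subst (jet_images m N \<one>\<^bsub>trunc_Aut m N\<^esub>) p = p" if "p \<in> carrier (poly_ring ?V)" for p
    using that
  proof (induction rule: poly_ring_induct)
    case (var v)
    then show ?case
      by (auto simp: jet_vars_def jet_images_def component_def trunc_Aut_def BijGroup_def trunc_class_closed
          ps_var_closed jet_trunc_class jet_var)
  qed (simp_all add: poly_subst_add poly_subst_mult)
  then show ?thesis by (auto simp: jet_aut_def fun_eq_iff)
qed

text \<open>Bijectivity comes from the group structure: by \<open>jet_aut_mult\<close> and
  \<open>jet_aut_one\<close>, the image of the inverse of \<open>\<phi>\<close> is a two-sided
  inverse.\<close>

lemma jet_aut_GA:
  assumes \<phi>: "\<phi> \<in> carrier (trunc_Aut m N)"
  shows "jet_aut m N \<phi> \<in> carrier (GA (jet_vars m N))"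
proof -
  interpret group "trunc_Aut m N" by (rule trunc_Aut_group)
  let ?R = "poly_ring (jet_vars m N)"
  have inverse: "jet_aut m N \<psi> (jet_aut m N \<psi>' p) = p"
    if "p \<in> carrier ?R" "\<psi> \<in> carrier (trunc_Aut m N)" "\<psi>' \<in> carrier (trunc_Aut m N)"
      "\<psi> \<otimes>\<^bsub>trunc_Aut m N\<^esub> \<psi>' = \<one>\<^bsub>trunc_Aut m N\<^esub>" for p \<psi> \<psi>'
    using fun_cong[OF jet_aut_mult[OF that(2,3)], of p] that(1,4) by (simp add: jet_aut_one compose_eq)
  have "bij_betw (jet_aut m N \<phi>) (carrier ?R) (carrier ?R)"
    using \<phi> by (intro bij_betw_byWitness[where f' = "jet_aut m N (inv\<^bsub>trunc_Aut m N\<^esub> \<phi>)"])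
      (auto simp: inverse jet_aut_closed)
  then have "jet_aut m N \<phi> \<in> Bij (carrier ?R)"
    by (simp add: Bij_def jet_aut_def)
  moreover have "jet_aut m N \<phi> \<in> ring_hom ?R ?R"
    by (rule ring_hom_memI)
      (simp_all add: jet_aut_closed, simp_all add: jet_aut_def poly_closed poly_subst_add poly_subst_mult)
  moreover have "jet_aut m N \<phi> (poly_const c) = poly_const c" for c
    by (simp add: jet_aut_def poly_const_closed)
  ultimately show ?thesis by (simp add: GA_def alg_autI)
qed

lemma jet_aut_hom: "jet_aut m N \<in> hom (trunc_Aut m N) (GA (jet_vars m N))"
proof (rule homI)
  fix \<phi> \<psi> :: "'k::comm_ring_1 power_series set \<Rightarrow> 'k power_series set"
  assume *: "\<phi> \<in> carrier (trunc_Aut m N)" "\<psi> \<in> carrier (trunc_Aut m N)"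
  then have "jet_aut m N \<phi> \<in> Bij (carrier (poly_ring (jet_vars m N)))"
    "jet_aut m N \<psi> \<in> Bij (carrier (poly_ring (jet_vars m N)))"
    using jet_aut_GA alg_aut_Bij by (fastforce simp: GA_def)+
  then show "jet_aut m N (\<phi> \<otimes>\<^bsub>trunc_Aut m N\<^esub> \<psi>)
      = jet_aut m N \<phi> \<otimes>\<^bsub>GA (jet_vars m N)\<^esub> jet_aut m N \<psi>"
    by (simp add: GA_def BijGroup_def jet_aut_mult[OF *])
qed (rule jet_aut_GA)

section \<open>Recovering the series from the automorphism\<close>

lemma row_exponent_sum: "row_exponent (sum f A) = (\<Sum>x\<in>A. row_exponent (f x))"
  by (induction A rule: infinite_finite_induct) auto

lemma weight_sum: "weight (sum f A) = (\<Sum>x\<in>A. weight (f x))"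
  by (induction A rule: infinite_finite_induct) auto

text \<open>The monomial with exponents \<open>a\<close> placed in the first column has factor 1, so
  \<open>f a\<close> itself is a coefficient of the jet and no division is involved.\<close>

lemma jet_determines_coeff:
  fixes f g :: "'k::comm_ring_1 power_series"
  assumes "jet m N (mdeg a) f = jet m N (mdeg a) g" and "keys a \<subseteq> {1..m}" and "1 \<le> N"
  shows "f a = g a"
proof -
  define \<mu> where "\<mu> = (\<Sum>l\<in>keys a. single (l, 1::nat) (lookup a l))"
  have row: "row_exponent \<mu> = a"
    unfolding \<mu>_def row_exponent_sum row_exponent_single by (rule poly_sum_singles[symmetric])
  have weight: "weight \<mu> = mdeg a"
    by (simp add: \<mu>_def weight_sum mdeg_def)
  have "keys \<mu> \<subseteq> (\<lambda>l. (l, 1)) ` keys a"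
    unfolding \<mu>_def by (rule order_trans[OF keys_sum]) (auto split: if_splits)
  \<comment> \<open>\<open>1 \<le> N\<close> ensures that the first column belongs to the
    variables.\<close>
  then have keys: "keys \<mu> \<subseteq> {1..m} \<times> {1..N}" and "snd ` keys \<mu> \<subseteq> {1}"
    using assms(2,3) by auto
  then have "universal_factor (mdeg a) \<mu> = 1"
    by (simp add: universal_factor_def weight multinomial_factor_first_column)
  then show ?thesis
    using arg_cong[OF assms(1), of "\<lambda>p. lookup p \<mu>"] keys by (simp add: lookup_jet row)
qed

lemma jet_aut_inj:
  assumes "1 \<le> N"
  shows "inj_on (jet_aut m N) (carrier (trunc_Aut m N))"
proof (rule inj_onI, rule trunc_hom_eqI)
  fix \<phi> \<psi> i
  assume \<phi>: "\<phi> \<in> carrier (trunc_Aut m N)" and \<psi>: "\<psi> \<in> carrier (trunc_Aut m N)"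
    and eq: "jet_aut m N \<phi> = jet_aut m N \<psi>" and i: "i \<in> {1..m}"
  show "component m N \<phi> i = component m N \<psi> i"
  proof (rule trunc_eqI[OF trunc_AutD(4)[OF \<phi> i] trunc_AutD(4)[OF \<psi> i]])
    fix a assume a: "mdeg a \<le> N" "keys a \<subseteq> {1..m}"
    show "trunc_coeff (component m N \<phi> i) a = trunc_coeff (component m N \<psi> i) a"
    proof (cases "a = 0")
      \<comment> \<open>The second index of a variable starts at 1, so no image shows the constant
        term as a jet at 0. It vanishes for both automorphisms.\<close>
      case True
      then show ?thesis using trunc_AutD(5)[OF \<phi> i] trunc_AutD(5)[OF \<psi> i] by simp
    next
      case False
      then have "mdeg a \<noteq> 0" by simp
      then have "mdeg a \<in> {1..N}" using a(1) by (simp only: atLeastAtMost_iff less_one not_less[symmetric] simp_thms)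
      then have "jet m N (mdeg a) (trunc_coeff (component m N \<phi> i))
          = jet m N (mdeg a) (trunc_coeff (component m N \<psi> i))"
        using jet_aut_var[OF i, of "mdeg a" N] eq by metis
      then show ?thesis using a(2) assms by (rule jet_determines_coeff)
    qed
  qed
qed

theorem theorem4p1:
  fixes m N :: nat
  assumes "1 \<le> m" and "1 \<le> N"
  shows "\<exists>\<alpha> :: ('k::{comm_ring_1, ring_char_0} power_series set \<Rightarrow> 'k power_series set)
               \<Rightarrow> ((nat \<times> nat, 'k) polynomial \<Rightarrow> (nat \<times> nat, 'k) polynomial).
    group_hom (trunc_Aut m N) (GA ({1..m} \<times> {1..N})) \<alpha>
    \<and> inj_on \<alpha> (carrier (trunc_Aut m N))
    \<and> (\<forall>\<phi>\<in>carrier (trunc_Aut m N). \<forall>i\<in>{1..m}. \<forall>j\<in>{1..N}.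
         total_degree (\<alpha> \<phi> (poly_var (i, j))) \<le> N
         \<and> (\<forall>\<mu>. Poly_Mapping.keys \<mu> \<subseteq> {1..m} \<times> {1..N} \<longrightarrow>
              Poly_Mapping.lookup (\<alpha> \<phi> (poly_var (i, j))) \<mu>
              = of_nat (universal_factor j \<mu>)
                * trunc_coeff (component m N \<phi> i) (row_exponent \<mu>)))"
proof (intro exI[of _ "jet_aut m N"] conjI ballI allI impI)
  show "group_hom (trunc_Aut m N) (GA ({1..m} \<times> {1..N}))
      (jet_aut m N :: ('k power_series set \<Rightarrow> 'k power_series set) \<Rightarrow> _)"
    by (simp add: group_hom_def group_hom_axioms_def trunc_Aut_group GA_group jet_aut_hom[unfolded jet_vars_def, simplified])
  show "inj_on (jet_aut m N :: ('k power_series set \<Rightarrow> 'k power_series set) \<Rightarrow> _)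
      (carrier (trunc_Aut m N))"
    by (rule jet_aut_inj[OF assms(2)])
  fix \<phi> :: "'k power_series set \<Rightarrow> 'k power_series set" and i j :: nat
  assume ij: "i \<in> {1..m}" "j \<in> {1..N}"
  \<comment> \<open>The jet at \<open>j\<close> even has degree at most \<open>j\<close>.\<close>
  show "total_degree (jet_aut m N \<phi> (poly_var (i, j))) \<le> N"
    unfolding jet_aut_var[OF ij] by (rule order_trans[OF total_degree_jet]) (use ij in simp)
  show "lookup (jet_aut m N \<phi> (poly_var (i, j))) \<mu>
      = of_nat (universal_factor j \<mu>) * trunc_coeff (component m N \<phi> i) (row_exponent \<mu>)"
    if "keys \<mu> \<subseteq> {1..m} \<times> {1..N}" for \<mu>
    using that ij by (simp add: jet_aut_var lookup_jet)
qed

end
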